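(* Let $\sigma=\{\sigma_i \mid i\in I\}$ be a partition of the set $\mathbb{P}$ of all primes and let $G$ be a finite group. Suppose that $G$ has a normal $\sigma$-Hall subgroup $D$ such that: (i) $G/D$ is a $P\sigma T$-group, and (ii) every $\sigma$-subnormal subgroup of $D$ is normal in $G$. If $G$ is a $\sigma$-full group of Sylow type, then $G$ is a $P\sigma T$-group.
   Context: All groups are finite. $\sigma=\{\sigma_i\mid i\in I\}$ is a partition of $\mathbb{P}$: $\mathbb{P}=\bigcup_{i\in I}\sigma_i$ and $\sigma_i\cap\sigma_j=\emptyset$ for $i\neq j$. For a natural number $n$, $\sigma(n)=\{\sigma_i \mid \sigma_i\cap\pi(n)\neq\emptyset\}$, where $\pi(n)$ is the set of primes dividing $n$; $\sigma(G)=\sigma(|G|)$. For $\Pi\subseteq\sigma$, $\Pi'=\sigma\setminus\Pi$; $n$ is a $\Pi$-number if $\sigma(n)\subseteq\Pi$. A subgroup $A$ of $G$ is a Hall $\Pi$-subgroup if $|A|$ is a $\Pi$-number and $|G:A|$ is a $\Pi'$-number; it is a $\sigma$-Hall subgroup if it is a Hall $\Pi$-subgroup for some $\Pi\subseteq\sigma$. A Hall $\sigma_i$-subgroup means a Hall $\{\sigma_i\}$-subgroup. A group is $\sigma$-primary if $|\sigma(G)|\le 1$. For a set of primes $\pi$, $G$ is a $D_\pi$-group if $G$ has a Hall $\pi$-subgroup $E$ and every $\pi$-subgroup of $G$ lies in some conjugate of $E$. $G$ is a $\sigma$-full group of Sylow type if every subgroup $E$ of $G$ is a $D_{\sigma_i}$-group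 for every $\sigma_i\in\sigma(E)$. A complete Hall $\sigma$-set of $G$ is a set $\mathcal{H}$ of subgroups such that every nontrivial member is a Hall $\sigma_i$-subgroup of $G$ for some $i$, and $\mathcal{H}$ contains exactly one Hall $\sigma_i$-subgroup of $G$ for each $\sigma_i\in\sigma(G)$. A subgroup $A$ of $G$ is $\sigma$-quasinormal ($\sigma$-permutable) in $G$ if $G$ has a complete Hall $\sigma$-set $\mathcal{H}$ with $AH^x=H^xA$ for all $H\in\mathcal{H}$ and $x\in G$. A subgroup $A$ is $\sigma$-subnormal in $G$ if there is a chain $A=A_0\le A_1\le\cdots\le A_t=G$ such that for each $i$ either $A_{i-1}\trianglelefteq A_i$ or $A_i/(A_{i-1})_{A_i}$ is $\sigma$-primary, where $(A_{i-1})_{A_i}$ is the core of $A_{i-1}$ in $A_i$. $G$ is a $P\sigma T$-group if $\sigma$-quasinormality is transitive in $G$: whenever $K$ is $\sigma$-quasinormal in $H$ and $H$ is $\sigma$-quasinormal in $G$, $K$ is $\sigma$-quasinormal in $G$. *)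

theory Defs
  imports "HOL-Algebra.Algebra" "HOL-Library.Disjoint_Sets" "HOL-Computational_Algebra.Primes"
begin

text \<open>A partition of the set of all primes is modelled by a set of sets of primes
  (the blocks sigma_i) with partition_on.\<close>

definition all_primes :: "nat set" where
  "all_primes = {p::nat. Factorial_Ring.prime p}"

definition sig :: "nat set set \<Rightarrow> nat \<Rightarrow> nat set set" where
  "sig \<sigma> n = {s \<in> \<sigma>. s \<inter> prime_factors n \<noteq> {}}"

definition sig_number :: "nat set set \<Rightarrow> nat set set \<Rightarrow> nat \<Rightarrow> bool" where
  "sig_number \<sigma> Pi_s n \<longleftrightarrow> sig \<sigma> n \<subseteq> Pi_s"

definition hall_Pi :: "nat set set \<Rightarrow> ('a, 'b) monoid_scheme \<Rightarrow> nat set set \<Rightarrow> 'a set \<Rightarrow> bool" where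
  "hall_Pi \<sigma> G Pi_s A \<longleftrightarrow> subgroup A G \<and> sig_number \<sigma> Pi_s (card A)
      \<and> sig_number \<sigma> (\<sigma> - Pi_s) (order G div card A)"

definition sigma_hall :: "nat set set \<Rightarrow> ('a, 'b) monoid_scheme \<Rightarrow> 'a set \<Rightarrow> bool" where
  "sigma_hall \<sigma> G A \<longleftrightarrow> (\<exists>Pi_s. Pi_s \<subseteq> \<sigma> \<and> hall_Pi \<sigma> G Pi_s A)"

definition sigma_primary :: "nat set set \<Rightarrow> ('a, 'b) monoid_scheme \<Rightarrow> bool" where
  "sigma_primary \<sigma> G \<longleftrightarrow> card (sig \<sigma> (order G)) \<le> 1"

definition hall_primes :: "('a, 'b) monoid_scheme \<Rightarrow> nat set \<Rightarrow> 'a set \<Rightarrow> bool" where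
  "hall_primes G \<pi> E \<longleftrightarrow> subgroup E G \<and> prime_factors (card E) \<subseteq> \<pi>
      \<and> prime_factors (order G div card E) \<inter> \<pi> = {}"

definition D_pi :: "('a, 'b) monoid_scheme \<Rightarrow> nat set \<Rightarrow> bool" where
  "D_pi G \<pi> \<longleftrightarrow> (\<exists>E. hall_primes G \<pi> E \<and>
      (\<forall>K. subgroup K G \<and> prime_factors (card K) \<subseteq> \<pi> \<longrightarrow>
         (\<exists>x\<in>carrier G. K \<subseteq> (inv\<^bsub>G\<^esub> x) <#\<^bsub>G\<^esub> E #>\<^bsub>G\<^esub> x)))"

definition sigma_full_Sylow :: "nat set set \<Rightarrow> ('a, 'b) monoid_scheme \<Rightarrow> bool" where
  "sigma_full_Sylow \<sigma> G \<longleftrightarrow> (\<forall>E. subgroup E G \<longrightarrow>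
      (\<forall>s\<in>sig \<sigma> (card E). D_pi (G\<lparr>carrier := E\<rparr>) s))"

definition complete_hall_set :: "nat set set \<Rightarrow> ('a, 'b) monoid_scheme \<Rightarrow> 'a set set \<Rightarrow> bool" where
  "complete_hall_set \<sigma> G \<H> \<longleftrightarrow> (\<forall>H\<in>\<H>. subgroup H G)
     \<and> (\<forall>H\<in>\<H>. H \<noteq> {\<one>\<^bsub>G\<^esub>} \<longrightarrow> (\<exists>s\<in>\<sigma>. hall_Pi \<sigma> G {s} H))
     \<and> (\<forall>s\<in>sig \<sigma> (order G). \<exists>!H. H \<in> \<H> \<and> hall_Pi \<sigma> G {s} H)"

definition sigma_quasinormal :: "nat set set \<Rightarrow> ('a, 'b) monoid_scheme \<Rightarrow> 'a set \<Rightarrow> bool" where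
  "sigma_quasinormal \<sigma> G A \<longleftrightarrow> subgroup A G \<and> (\<exists>\<H>. complete_hall_set \<sigma> G \<H> \<and>
      (\<forall>H\<in>\<H>. \<forall>x\<in>carrier G.
         A <#>\<^bsub>G\<^esub> ((inv\<^bsub>G\<^esub> x) <#\<^bsub>G\<^esub> H #>\<^bsub>G\<^esub> x)
         = ((inv\<^bsub>G\<^esub> x) <#\<^bsub>G\<^esub> H #>\<^bsub>G\<^esub> x) <#>\<^bsub>G\<^esub> A))"

definition core :: "('a, 'b) monoid_scheme \<Rightarrow> 'a set \<Rightarrow> 'a set" where
  "core G A = (\<Inter>x\<in>carrier G. (inv\<^bsub>G\<^esub> x) <#\<^bsub>G\<^esub> A #>\<^bsub>G\<^esub> x)"

text \<open>sigma-subnormality via a chain A = A_0 <= A_1 <= ... <= A_t = G, built from the top.\<close>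

inductive sigma_subnormal :: "nat set set \<Rightarrow> ('a, 'b) monoid_scheme \<Rightarrow> 'a set \<Rightarrow> bool"
  for \<sigma> G where
  top: "sigma_subnormal \<sigma> G (carrier G)"
| step: "\<lbrakk> sigma_subnormal \<sigma> G B; subgroup A (G\<lparr>carrier := B\<rparr>);
           A \<lhd> G\<lparr>carrier := B\<rparr> \<or>
           sigma_primary \<sigma> ((G\<lparr>carrier := B\<rparr>) Mod (core (G\<lparr>carrier := B\<rparr>) A)) \<rbrakk>
         \<Longrightarrow> sigma_subnormal \<sigma> G A"

definition PsigmaT :: "nat set set \<Rightarrow> ('a, 'b) monoid_scheme \<Rightarrow> bool" where
  "PsigmaT \<sigma> G \<longleftrightarrow> (\<forall>H K. sigma_quasinormal \<sigma> (G\<lparr>carrier := H\<rparr>) K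
       \<and> sigma_quasinormal \<sigma> G H \<longrightarrow> sigma_quasinormal \<sigma> G K)"

end

theory Submission
  imports Defs
begin

text \<open>
  Let K be quasinormal in H and H quasinormal in G, and let D be a Hall \<open>\<pi>\<close>-subgroup.

  A maximal proper quasinormal subgroup M of a group E is normal in E, or some Hall s-subgroup Q contains
  an x that does not normalise M; then E is generated by M and its conjugate under x, so E = MQ has
  s-index over M, and permutability forces M to contain every Hall t-subgroup of E for \<open>t \<noteq> s\<close>: the core of M
  has s-index. Hence quasinormal subgroups are \<open>\<sigma>\<close>-subnormal. Intersecting with D, both \<open>H \<inter> D\<close> and \<open>K \<inter> D\<close>
  are \<open>\<sigma>\<close>-subnormal in D, so \<open>K \<inter> D\<close> is normal in G.

  A t-subgroup of KD with t outside \<open>\<pi>\<close> lies in H (as HD has \<open>\<pi>\<close>-index over H), hence in \<open>KD \<inter> H = K(D \<inter> H)\<close>,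
  hence in K. Since K has \<open>\<pi>'\<close>-index over \<open>K \<inter> D\<close>, it equals its core in KD, that is, K is normal in KD.
  So K permutes with the Hall subgroups inside D. For a Hall s-subgroup Q with s outside \<open>\<pi>\<close>, the quotient G/D
  shows that U = KDQ is a subgroup; the core R of K in U has s-index in K, while \<open>K \<inter> Q\<close> is a
  Hall s-subgroup of K, so \<open>K = R(K \<inter> Q)\<close> and KQ = RQ = QR = QK.
\<close>

section \<open>Numbers with prescribed prime divisors and products of subgroups\<close>

text \<open>Stated through divisibility rather than \<open>prime_factors\<close>, so that passing to
  divisors and to products needs no positivity; \<open>prime_factors 0\<close> is empty although
  every prime divides 0.\<close>

definition pi_number :: "nat set \<Rightarrow> nat \<Rightarrow> bool" where
  "pi_number \<pi> n \<longleftrightarrow> (\<forall>p. Factorial_Ring.prime p \<longrightarrow> p dvd n \<longrightarrow> p \<in> \<pi>)"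

lemma pi_number_dvd: "pi_number \<pi> n \<Longrightarrow> m dvd n \<Longrightarrow> pi_number \<pi> m"
  unfolding pi_number_def using dvd_trans by blast

lemma pi_number_mult: "pi_number \<pi> (m * n) \<longleftrightarrow> pi_number \<pi> m \<and> pi_number \<pi> n"
  unfolding pi_number_def by (auto simp: prime_dvd_mult_iff)

lemma pi_number_mono: "pi_number \<pi> n \<Longrightarrow> \<pi> \<subseteq> \<rho> \<Longrightarrow> pi_number \<rho> n"
  unfolding pi_number_def by blast

lemma pi_number_one [simp]: "pi_number \<pi> (Suc 0)"
  unfolding pi_number_def by auto

text \<open>The counting device of the whole proof: an index that is both an s-number and an
  s'-number is 1, and \<open>index_eq_1\<close> then identifies the two subgroups.\<close>

lemma pi_number_eq_1:
  assumes "pi_number \<pi> n" "pi_number \<rho> n" "\<pi> \<inter> \<rho> = {}"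
  shows "n = 1"
  using assms prime_factor_nat[of n] unfolding pi_number_def by blast

lemma prime_factors_subset_iff:
  "0 < n \<Longrightarrow> prime_factors n \<subseteq> \<pi> \<longleftrightarrow> pi_number \<pi> n"
  unfolding pi_number_def by (auto simp: in_prime_factors_iff)

lemma prime_factors_disjoint_iff:
  "0 < n \<Longrightarrow> prime_factors n \<inter> \<pi> = {} \<longleftrightarrow> pi_number (- \<pi>) n"
  unfolding pi_number_def by (auto simp: in_prime_factors_iff)

text \<open>A prime lies in exactly one block, so the blocks met by the prime divisors of
  \<open>n\<close> all belong to \<open>Ps\<close> exactly when the prime divisors lie in the union
  of \<open>Ps\<close>. Sets of blocks are thereby traded for sets of primes.\<close>

lemma sig_number_iff:
  assumes "partition_on all_primes \<sigma>" "Ps \<subseteq> \<sigma>" "0 < n"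
  shows "sig_number \<sigma> Ps n \<longleftrightarrow> pi_number (\<Union>Ps) n"
proof
  assume *: "sig_number \<sigma> Ps n"
  show "pi_number (\<Union>Ps) n"
    unfolding pi_number_def
  proof (intro allI impI)
    fix p :: nat assume p: "Factorial_Ring.prime p" "p dvd n"
    then obtain s where s: "s \<in> \<sigma>" "p \<in> s"
      using assms(1) unfolding partition_on_def all_primes_def by auto
    have "s \<in> Ps"
      using * s p assms(3) in_prime_factors_iff[of p n] unfolding sig_number_def sig_def by blast
    then show "p \<in> \<Union>Ps" using s by blast
  qed
next
  assume *: "pi_number (\<Union>Ps) n"
  have "s \<in> Ps" if s: "s \<in> \<sigma>" and p: "p \<in> s" "p \<in> prime_factors n" for s p
  proof -
    obtain t where t: "t \<in> Ps" "p \<in> t"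
      using * p unfolding pi_number_def by (auto simp: in_prime_factors_iff)
    then have "s = t"
      using s p assms unfolding partition_on_def disjoint_def by blast
    then show ?thesis using t by simp
  qed
  then show "sig_number \<sigma> Ps n"
    unfolding sig_number_def sig_def by blast
qed

lemma Union_partition_Diff:
  assumes "partition_on all_primes \<sigma>" "Ps \<subseteq> \<sigma>"
  shows "\<Union>(\<sigma> - Ps) = all_primes - \<Union>Ps"
proof -
  have "\<Union>\<sigma> = all_primes" using assms(1) unfolding partition_on_def by simp
  moreover have "x \<notin> \<Union>Ps" if "x \<in> s" "s \<in> \<sigma> - Ps" for x s
  proof
    assume "x \<in> \<Union>Ps"
    then obtain t where "t \<in> Ps" "x \<in> t" by blast
    then show False
      using disjointD[OF partition_onD2[OF assms(1)], of s t] that assms(2) by blast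
  qed
  ultimately show ?thesis using assms(2) by blast
qed

text \<open>Only primes are tested, so complements may be taken in the whole type, which gives the
  short form \<open>- s\<close> used from here on.\<close>

lemma pi_number_Diff: "pi_number (all_primes - \<pi>) n \<longleftrightarrow> pi_number (- \<pi>) n"
  unfolding pi_number_def all_primes_def by blast

lemma sig_number_compl_iff:
  assumes "partition_on all_primes \<sigma>" "Ps \<subseteq> \<sigma>" "0 < n"
  shows "sig_number \<sigma> (\<sigma> - Ps) n \<longleftrightarrow> pi_number (- \<Union>Ps) n"
  using sig_number_iff[OF assms(1) _ assms(3), of "\<sigma> - Ps"] Union_partition_Diff[OF assms(1,2)]
  by (simp add: pi_number_Diff)

lemma mem_sig_iff:
  assumes "0 < n" "s \<in> \<sigma>"
  shows "s \<in> sig \<sigma> n \<longleftrightarrow> \<not> pi_number (- s) n"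
  using assms unfolding sig_def pi_number_def by (auto simp: in_prime_factors_iff)

lemma set_mult_memI: "a \<in> A \<Longrightarrow> b \<in> B \<Longrightarrow> a \<otimes>\<^bsub>G\<^esub> b \<in> A <#>\<^bsub>G\<^esub> B"
  unfolding set_mult_def by blast

lemma set_mult_memE:
  assumes "x \<in> A <#>\<^bsub>G\<^esub> B"
  obtains a b where "a \<in> A" "b \<in> B" "x = a \<otimes>\<^bsub>G\<^esub> b"
  using assms unfolding set_mult_def by blast

section \<open>Orders, indices and products of subgroups of a finite group\<close>

locale fin_group = group +
  assumes fin [simp]: "finite (carrier G)"
begin

lemma finite_subgroup [simp]: "subgroup H G \<Longrightarrow> finite H"
  using fin finite_subset subgroup.subset by blast

lemma card_subgroup_pos: "subgroup H G \<Longrightarrow> 0 < card H"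
  by (simp add: subgroup.finite_imp_card_positive)

lemma fin_group_subgroup: "subgroup H G \<Longrightarrow> fin_group (G\<lparr>carrier := H\<rparr>)"
  by (simp add: fin_group_def fin_group_axioms_def subgroup_imp_group)

lemma card_subgroup_dvd:
  assumes "subgroup A G" "subgroup B G" "A \<subseteq> B"
  shows "card A dvd card B"
proof -
  interpret B: group "G\<lparr>carrier := B\<rparr>" using assms subgroup_imp_group by blast
  have "subgroup A (G\<lparr>carrier := B\<rparr>)" using assms subgroup_incl by blast
  from B.lagrange[OF this] show ?thesis
    by (auto simp: order_def intro: dvdI[OF trans[OF sym mult.commute]])
qed

lemma index_eq_1:
  assumes "subgroup A G" "subgroup B G" "A \<subseteq> B" "card B div card A = 1"
  shows "A = B"
proof -
  have "card B = card A"
    using card_subgroup_dvd[OF assms(1-3)] assms(4) by (metis dvd_div_mult_self mult_1)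
  then show ?thesis using assms by (simp add: card_subset_eq)
qed

lemma index_mult:
  assumes "subgroup A G" "subgroup B G" "subgroup C G" "A \<subseteq> B" "B \<subseteq> C"
  shows "card C div card A = (card C div card B) * (card B div card A)"
proof -
  obtain a b where ab: "card B = card A * a" "card C = card B * b"
    using card_subgroup_dvd[OF assms(1,2,4)] card_subgroup_dvd[OF assms(2,3,5)] unfolding dvd_def by blast
  then have "card C = card A * (b * a)" by simp
  then show ?thesis
    using ab card_subgroup_pos[OF assms(1)] card_subgroup_pos[OF assms(2)] by simp
qed

lemma index_dvd:
  assumes "subgroup A G" "subgroup B G" "A \<subseteq> B"
  shows "card B div card A dvd card B"
  using card_subgroup_dvd[OF assms] by (metis dvd_div_mult_self dvd_triv_left)

lemma index_pos:
  assumes "subgroup A G" "subgroup B G" "A \<subseteq> B"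
  shows "0 < card B div card A"
  using card_subgroup_dvd[OF assms] card_subgroup_pos assms
  by (simp add: card_mono div_greater_zero_iff)

lemma inv_cancel [simp]:
  assumes "x \<in> carrier G" "y \<in> carrier G"
  shows "inv x \<otimes> (x \<otimes> y) = y" "x \<otimes> (inv x \<otimes> y) = y"
  using assms by (simp_all flip: m_assoc)

text \<open>For each \<open>y\<close> in the product one factorisation, with first factor
  \<open>a y\<close>, is chosen. All other factorisations of \<open>y\<close> arise from it by
  shifting an element of the intersection from one factor to the other.\<close>

lemma card_set_mult:
  assumes A: "subgroup A G" and B: "subgroup B G"
  shows "card (A <#> B) * card (A \<inter> B) = card A * card B"
proof -
  interpret A: subgroup A G by fact
  interpret B: subgroup B G by fact
  have "\<forall>y\<in>A <#> B. \<exists>x. x \<in> A \<and> inv x \<otimes> y \<in> B"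
    unfolding set_mult_def by force
  then obtain a where a: "\<And>y. y \<in> A <#> B \<Longrightarrow> a y \<in> A \<and> inv (a y) \<otimes> y \<in> B"
    by metis
  have AB: "x \<otimes> y \<in> A <#> B" if "x \<in> A" "y \<in> B" for x y
    using that unfolding set_mult_def by blast
  have ABc: "y \<in> carrier G" if "y \<in> A <#> B" for y
    using that setmult_subset_G[OF A.subset B.subset] by blast
  \<comment> \<open>\<open>g\<close> shifts the chosen factorisation of \<open>y\<close> by
    \<open>c\<close>; \<open>g'\<close> multiplies a pair out and recovers the shift by comparison
    with the chosen first factor.\<close>
  define g where "g = (\<lambda>(y, c). (a y \<otimes> c, inv c \<otimes> (inv (a y) \<otimes> y)))"
  define g' where "g' = (\<lambda>(x, z). (x \<otimes> z, inv (a (x \<otimes> z)) \<otimes> x))"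
  have "bij_betw g ((A <#> B) \<times> (A \<inter> B)) (A \<times> B)"
  proof (rule bij_betw_byWitness[where f' = g'])
    show "\<forall>yc\<in>(A <#> B) \<times> (A \<inter> B). g' (g yc) = yc"
    proof
      fix yc assume "yc \<in> (A <#> B) \<times> (A \<inter> B)"
      then obtain y c where yc: "yc = (y, c)" "y \<in> A <#> B" "c \<in> A" "c \<in> B" by blast
      then show "g' (g yc) = yc"
        using a[OF yc(2)] ABc[OF yc(2)] by (simp add: g_def g'_def m_assoc)
    qed
    show "\<forall>xz\<in>A \<times> B. g (g' xz) = xz"
    proof
      fix xz assume "xz \<in> A \<times> B"
      then obtain x z where xz: "xz = (x, z)" "x \<in> A" "z \<in> B" by blast
      then show "g (g' xz) = xz"
        using a[OF AB[OF xz(2,3)]] by (simp add: g_def g'_def inv_mult_group m_assoc)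
    qed
    show "g ` ((A <#> B) \<times> (A \<inter> B)) \<subseteq> A \<times> B"
      using a by (auto simp: g_def)
    show "g' ` (A \<times> B) \<subseteq> (A <#> B) \<times> (A \<inter> B)"
    proof -
      have "inv (a (x \<otimes> z)) \<otimes> x \<in> B" if "x \<in> A" "z \<in> B" for x z
      proof -
        have "(inv (a (x \<otimes> z)) \<otimes> (x \<otimes> z)) \<otimes> inv z \<in> B"
          using a[OF AB[OF that]] that by blast
        then show ?thesis using a[OF AB[OF that]] that by (simp add: m_assoc)
      qed
      then show ?thesis using a AB by (auto simp: g'_def)
    qed
  qed
  from bij_betw_same_card[OF this] show ?thesis by (simp add: card_cartesian_product)
qed

lemma subgroup_set_mult:
  assumes A: "subgroup A G" and B: "subgroup B G" and AB: "A <#> B = B <#> A"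
  shows "subgroup (A <#> B) G"
proof (rule subgroupI)
  interpret A: subgroup A G by fact
  interpret B: subgroup B G by fact
  show "A <#> B \<subseteq> carrier G" using setmult_subset_G A.subset B.subset by blast
  show "A <#> B \<noteq> {}" using set_mult_memI[OF A.one_closed B.one_closed] by auto
  show "inv x \<in> A <#> B" if "x \<in> A <#> B" for x
  proof -
    obtain a b where ab: "a \<in> A" "b \<in> B" "x = a \<otimes> b" using \<open>x \<in> A <#> B\<close> by (rule set_mult_memE)
    then have "inv x = inv b \<otimes> inv a" by (simp add: inv_mult_group)
    also have "\<dots> \<in> B <#> A" using ab by (blast intro: set_mult_memI)
    finally show ?thesis using AB by simp
  qed
  show "x \<otimes> y \<in> A <#> B" if x: "x \<in> A <#> B" and y: "y \<in> A <#> B" for x y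
  proof -
    obtain a b where ab: "a \<in> A" "b \<in> B" "x = a \<otimes> b" using x by (rule set_mult_memE)
    have "y \<in> B <#> A" using y AB by simp
    then obtain c d where cd: "d \<in> B" "c \<in> A" "y = d \<otimes> c" by (rule set_mult_memE)
    have "(b \<otimes> d) \<otimes> c \<in> A <#> B" using ab cd AB set_mult_memI[of "b \<otimes> d" B c A G] by simp
    then obtain e f where ef: "e \<in> A" "f \<in> B" "(b \<otimes> d) \<otimes> c = e \<otimes> f" by (rule set_mult_memE)
    have "x \<otimes> y = (a \<otimes> e) \<otimes> f" using ab cd ef by (simp add: m_assoc)
    then show ?thesis using ab ef by (simp add: set_mult_memI)
  qed
qed

lemma subset_set_mult:
  assumes "subgroup A G" "subgroup B G"
  shows "A \<subseteq> A <#> B" "B \<subseteq> A <#> B"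
proof -
  interpret A: subgroup A G by fact
  interpret B: subgroup B G by fact
  show "A \<subseteq> A <#> B" using set_mult_memI[OF _ B.one_closed, of _ A G] by (metis A.mem_carrier r_one subsetI)
  show "B \<subseteq> A <#> B" using set_mult_memI[OF A.one_closed, of _ B G] by (metis B.mem_carrier l_one subsetI)
qed

lemma set_mult_least:
  assumes "subgroup C G" "A \<subseteq> C" "B \<subseteq> C"
  shows "A <#> B \<subseteq> C"
  using assms subgroup.m_closed[OF assms(1)] unfolding set_mult_def by blast

text \<open>By \<open>card_set_mult\<close> both products have the same finite cardinality, so one
  inclusion suffices.\<close>

lemma set_mult_commute_if_subset:
  assumes "subgroup A G" "subgroup B G" "A <#> B \<subseteq> B <#> A"
  shows "A <#> B = B <#> A"
proof (rule card_subset_eq)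
  show "finite (B <#> A)" 
    by (rule finite_subset[OF setmult_subset_G fin]) (simp_all add: assms subgroup.subset)
  have "card (A <#> B) * card (A \<inter> B) = card (B <#> A) * card (A \<inter> B)"
    using card_set_mult[OF assms(1,2)] card_set_mult[OF assms(2,1)] by (simp add: Int_commute mult.commute)
  then show "card (A <#> B) = card (B <#> A)"
    using card_subgroup_pos[OF subgroups_Inter_pair[OF assms(1,2)]] by simp
qed fact

lemma index_set_mult:
  assumes "subgroup A G" "subgroup B G"
  shows "card (A <#> B) div card A = card B div card (A \<inter> B)"
proof -
  have "card (A \<inter> B) dvd card A" "card (A \<inter> B) dvd card B"
    using assms subgroups_Inter_pair by (auto intro!: card_subgroup_dvd)
  then obtain a b where ab: "card A = card (A \<inter> B) * a" "card B = card (A \<inter> B) * b" unfolding dvd_def by blast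
  have pos: "0 < card (A \<inter> B)" "0 < card A" using assms card_subgroup_pos subgroups_Inter_pair by auto
  have "card (A <#> B) = card A * b"
  proof -
    have "card (A \<inter> B) * card (A <#> B) = card (A \<inter> B) * (card A * b)"
      using card_set_mult[OF assms] ab(2) by (simp add: ac_simps)
    then show ?thesis using pos(1) by simp
  qed
  then show ?thesis using ab pos by simp
qed

text \<open>Dedekind's modular law on both sides: if \<open>a \<otimes> q\<close> lies in
  \<open>E\<close> and \<open>a\<close> does, then so does \<open>q\<close>.\<close>

lemma set_mult_modular:
  assumes "subgroup A G" "subgroup E G" "A \<subseteq> E" "Q \<subseteq> carrier G"
  shows "(A <#> Q) \<inter> E = A <#> (Q \<inter> E)" "(Q <#> A) \<inter> E = (Q \<inter> E) <#> A"
proof -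
  interpret A: subgroup A G by fact
  interpret E: subgroup E G by fact
  have 1: "q \<in> E" if "a \<in> A" "q \<in> Q" "a \<otimes> q \<in> E" for a q
  proof -
    have "inv a \<otimes> (a \<otimes> q) \<in> E" using that assms by (meson E.m_closed E.m_inv_closed subsetD)
    moreover have "q \<in> carrier G" using that assms by blast
    ultimately show ?thesis using that by simp
  qed
  have 2: "q \<in> E" if "a \<in> A" "q \<in> Q" "q \<otimes> a \<in> E" for a q
  proof -
    have "(q \<otimes> a) \<otimes> inv a \<in> E" using that assms by (meson E.m_closed E.m_inv_closed subsetD)
    moreover have "q \<in> carrier G" using that assms by blast
    ultimately show ?thesis using that by (simp add: m_assoc)
  qed
  show "(A <#> Q) \<inter> E = A <#> (Q \<inter> E)"
    using 1 assms(3) by (auto elim!: set_mult_memE intro!: set_mult_memI)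
  show "(Q <#> A) \<inter> E = (Q \<inter> E) <#> A"
    using 2 assms(3) by (auto elim!: set_mult_memE intro!: set_mult_memI)
qed

end

section \<open>Conjugates and Hall subgroups\<close>

text \<open>Names the term that \<open>D_pi\<close>, \<open>sigma_quasinormal\<close> and
  \<open>core\<close> contain in expanded form.\<close>

definition conjugate :: "('a, 'b) monoid_scheme \<Rightarrow> 'a \<Rightarrow> 'a set \<Rightarrow> 'a set" where
  "conjugate G x H = (inv\<^bsub>G\<^esub> x) <#\<^bsub>G\<^esub> H #>\<^bsub>G\<^esub> x"

lemma conjugate_eq_image: "conjugate G x H = (\<lambda>h. inv\<^bsub>G\<^esub> x \<otimes>\<^bsub>G\<^esub> h \<otimes>\<^bsub>G\<^esub> x) ` H"
  unfolding conjugate_def l_coset_def r_coset_def by auto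

lemma conjugate_mono: "A \<subseteq> B \<Longrightarrow> conjugate G x A \<subseteq> conjugate G x B"
  unfolding conjugate_eq_image by blast

lemma sigma_quasinormal_conjugate:
  "sigma_quasinormal \<sigma> G A \<longleftrightarrow> subgroup A G \<and> (\<exists>\<H>. complete_hall_set \<sigma> G \<H> \<and>
    (\<forall>H\<in>\<H>. \<forall>x\<in>carrier G. A <#>\<^bsub>G\<^esub> conjugate G x H = conjugate G x H <#>\<^bsub>G\<^esub> A))"
  unfolding conjugate_def by (rule sigma_quasinormal_def)

text \<open>With \<open>E\<close> as a parameter, Hall subgroups of all subgroups are handled inside
  one group \<open>G\<close>, without changing carriers; \<open>Hall_sub_restrict\<close> translates
  between the two views.\<close>

definition Hall_sub :: "('a, 'b) monoid_scheme \<Rightarrow> 'a set \<Rightarrow> nat set \<Rightarrow> 'a set \<Rightarrow> bool" where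
  "Hall_sub G E s Q \<longleftrightarrow> subgroup Q G \<and> Q \<subseteq> E \<and> pi_number s (card Q)
    \<and> pi_number (- s) (card E div card Q)"

context fin_group begin

lemma inj_on_conjugation: "x \<in> carrier G \<Longrightarrow> inj_on (\<lambda>h. inv x \<otimes> h \<otimes> x) (carrier G)"
  by (rule inj_onI) simp

lemma card_conjugate: "H \<subseteq> carrier G \<Longrightarrow> x \<in> carrier G \<Longrightarrow> card (conjugate G x H) = card H"
  unfolding conjugate_eq_image using inj_on_conjugation card_image inj_on_subset by blast

lemma conjugate_conjugate:
  assumes "H \<subseteq> carrier G" "x \<in> carrier G" "y \<in> carrier G"
  shows "conjugate G y (conjugate G x H) = conjugate G (x \<otimes> y) H"
  unfolding conjugate_eq_image image_image using assms
  by (intro image_cong refl) (auto simp: inv_mult_group m_assoc subset_iff)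

lemma conjugate_one: "H \<subseteq> carrier G \<Longrightarrow> conjugate G \<one> H = H"
  unfolding conjugate_eq_image by (auto simp: image_iff subset_iff)

lemma conjugate_set_mult:
  assumes "A \<subseteq> carrier G" "B \<subseteq> carrier G" "x \<in> carrier G"
  shows "conjugate G x (A <#> B) = conjugate G x A <#> conjugate G x B"
proof -
  have *: "inv x \<otimes> (a \<otimes> b) \<otimes> x = (inv x \<otimes> a \<otimes> x) \<otimes> (inv x \<otimes> b \<otimes> x)" if "a \<in> A" "b \<in> B" for a b
    using that assms by (simp add: m_assoc subset_iff)
  show ?thesis
    unfolding set_mult_def conjugate_eq_image by (simp add: image_UN * cong: SUP_cong)
qed

lemma conjugate_subset:
  assumes "subgroup E G" "H \<subseteq> E" "x \<in> E"
  shows "conjugate G x H \<subseteq> E"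
proof -
  interpret E: subgroup E G by fact
  show ?thesis unfolding conjugate_eq_image using assms by auto
qed

lemma subgroup_conjugate:
  assumes H: "subgroup H G" and x: "x \<in> carrier G"
  shows "subgroup (conjugate G x H) G"
proof (rule subgroupI)
  interpret H: subgroup H G by fact
  show "conjugate G x H \<subseteq> carrier G"
    by (rule conjugate_subset[OF subgroup_self H.subset x])
  show "conjugate G x H \<noteq> {}" unfolding conjugate_eq_image using H.one_closed by (metis empty_iff image_is_empty)
  show "inv a \<in> conjugate G x H" if a: "a \<in> conjugate G x H" for a
  proof -
    obtain h where h: "h \<in> H" "a = inv x \<otimes> h \<otimes> x" using a unfolding conjugate_eq_image by auto
    then have "inv a = inv x \<otimes> inv h \<otimes> x" using x by (simp add: inv_mult_group m_assoc)
    then show ?thesis unfolding conjugate_eq_image using h by simp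
  qed
  show "a \<otimes> b \<in> conjugate G x H" if ab: "a \<in> conjugate G x H" "b \<in> conjugate G x H" for a b
    using set_mult_memI[OF ab, of G]
    unfolding conjugate_set_mult[OF H.subset H.subset x, symmetric] subgroup_mult_id[OF H] .
qed

lemma normal_iff_conjugate:
  assumes "subgroup H G"
  shows "H \<lhd> G \<longleftrightarrow> (\<forall>x\<in>carrier G. conjugate G x H \<subseteq> H)"
proof -
  have "x \<otimes> h \<otimes> inv x \<in> H" if "\<forall>x\<in>carrier G. conjugate G x H \<subseteq> H" "x \<in> carrier G" "h \<in> H" for x h
    using bspec[OF that(1), of "inv x"] that(2,3) unfolding conjugate_eq_image by auto
  moreover have "inv x \<otimes> h \<otimes> x \<in> H" if "H \<lhd> G" "x \<in> carrier G" "h \<in> H" for x h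
    using normal.inv_op_closed1[OF that] .
  ultimately show ?thesis
    unfolding normal_inv_iff using assms by (auto simp: conjugate_eq_image normal_inv_iff)
qed

lemma subgroup_restrict_iff:
  assumes "subgroup E G"
  shows "subgroup A (G\<lparr>carrier := E\<rparr>) \<longleftrightarrow> subgroup A G \<and> A \<subseteq> E"
  using incl_subgroup[OF assms, of A] subgroup_incl[OF _ assms, of A]
    subgroup.subset[of A "G\<lparr>carrier := E\<rparr>"] by auto

lemma conjugate_restrict:
  assumes "subgroup E G" "x \<in> E"
  shows "conjugate (G\<lparr>carrier := E\<rparr>) x H = conjugate G x H"
  using assms by (simp add: conjugate_def)

lemma normal_restrict_iff:
  assumes "subgroup E G"
  shows "A \<lhd> G\<lparr>carrier := E\<rparr> \<longleftrightarrow> subgroup A G \<and> A \<subseteq> E \<and> (\<forall>x\<in>E. conjugate G x A \<subseteq> A)"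
proof -
  have "A \<lhd> G\<lparr>carrier := E\<rparr> \<longleftrightarrow> subgroup A (G\<lparr>carrier := E\<rparr>) \<and>
      (\<forall>x\<in>carrier (G\<lparr>carrier := E\<rparr>). conjugate (G\<lparr>carrier := E\<rparr>) x A \<subseteq> A)"
    using fin_group.normal_iff_conjugate[OF fin_group_subgroup[OF assms]] normal_imp_subgroup by blast
  also have "\<dots> \<longleftrightarrow> subgroup A (G\<lparr>carrier := E\<rparr>) \<and> (\<forall>x\<in>E. conjugate G x A \<subseteq> A)"
    by (simp add: conjugate_restrict[OF assms])
  also have "\<dots> \<longleftrightarrow> subgroup A G \<and> A \<subseteq> E \<and> (\<forall>x\<in>E. conjugate G x A \<subseteq> A)"
    unfolding subgroup_restrict_iff[OF assms] by (rule conj_assoc)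
  finally show ?thesis .
qed

lemma Hall_sub_restrict:
  assumes "subgroup E G" "F \<subseteq> E"
  shows "Hall_sub (G\<lparr>carrier := E\<rparr>) F s Q \<longleftrightarrow> Hall_sub G F s Q"
  using subgroup_restrict_iff[OF assms(1), of Q] assms(2) unfolding Hall_sub_def by auto

lemma hall_Pi_iff:
  assumes "partition_on all_primes \<sigma>" "Ps \<subseteq> \<sigma>"
  shows "hall_Pi \<sigma> G Ps A \<longleftrightarrow> Hall_sub G (carrier G) (\<Union>Ps) A"
proof (cases "subgroup A G")
  case True
  then have "0 < card A" "0 < order G div card A" "A \<subseteq> carrier G"
    using card_subgroup_pos[OF True] index_pos[OF True subgroup_self] subgroup.subset[OF True]
    unfolding order_def by auto
  then show ?thesis
    using True sig_number_iff[OF assms, of "card A"] sig_number_compl_iff[OF assms, of "order G div card A"]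
    unfolding hall_Pi_def Hall_sub_def by (simp add: order_def)
qed (simp add: hall_Pi_def Hall_sub_def)

lemma hall_primes_iff: "hall_primes G s A \<longleftrightarrow> Hall_sub G (carrier G) s A"
proof (cases "subgroup A G")
  case True
  then have "0 < card A" "0 < order G div card A" "A \<subseteq> carrier G"
    using card_subgroup_pos[OF True] index_pos[OF True subgroup_self] subgroup.subset[OF True]
    unfolding order_def by auto
  then show ?thesis
    using True unfolding hall_primes_def Hall_sub_def
    by (simp add: prime_factors_subset_iff prime_factors_disjoint_iff order_def)
qed (simp add: hall_primes_def Hall_sub_def)

lemma Hall_sub_conjugate:
  assumes "subgroup E G" "Hall_sub G E s Q" "x \<in> E"
  shows "Hall_sub G E s (conjugate G x Q)"
proof -
  have "subgroup Q G" "Q \<subseteq> E" "Q \<subseteq> carrier G" "x \<in> carrier G"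
    using assms subgroup.subset by (auto simp: Hall_sub_def)
  then show ?thesis
    using assms card_conjugate[of Q x] conjugate_subset[of E Q x] subgroup_conjugate[of Q x]
    by (simp add: Hall_sub_def)
qed

text \<open>The index of \<open>Q\<close> in \<open>P\<close> divides the s-number |P| and the
  s'-number |E:Q|, so it is 1.\<close>

lemma Hall_sub_maximal:
  assumes "subgroup E G" "Hall_sub G E s Q" "subgroup P G" "P \<subseteq> E" "Q \<subseteq> P" "pi_number s (card P)"
  shows "Q = P"
proof -
  have Q: "subgroup Q G" using assms by (simp add: Hall_sub_def)
  have "pi_number s (card P div card Q)"
    using card_subgroup_dvd[OF Q assms(3,5)] assms(6) by (metis dvd_div_mult_self pi_number_mult)
  moreover have "pi_number (- s) (card P div card Q)"
    using index_mult[OF Q assms(3,1,5,4)] assms(2) by (simp add: Hall_sub_def pi_number_mult)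
  ultimately show ?thesis using index_eq_1[OF Q assms(3,5)] pi_number_eq_1[of s _ "- s"] by auto
qed

text \<open>A complete Hall set amounts to an independent choice of one Hall subgroup for each block
  in \<sigma>(G). This removes the set \<H> from all later arguments.\<close>

lemma sigma_quasinormal_iff:
  assumes part: "partition_on all_primes \<sigma>"
  shows "sigma_quasinormal \<sigma> G A \<longleftrightarrow> subgroup A G \<and>
    (\<forall>s\<in>sig \<sigma> (order G). \<exists>Q. Hall_sub G (carrier G) s Q \<and>
      (\<forall>x\<in>carrier G. A <#> conjugate G x Q = conjugate G x Q <#> A))"
proof -
  have hall: "hall_Pi \<sigma> G {s} Q \<longleftrightarrow> Hall_sub G (carrier G) s Q" if "s \<in> \<sigma>" for s Q
    using hall_Pi_iff[OF part, of "{s}"] that by simp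
  have sig: "s \<in> \<sigma>" if "s \<in> sig \<sigma> (order G)" for s
    using that by (simp add: sig_def)
  show ?thesis
  proof
    assume "sigma_quasinormal \<sigma> G A"
    then obtain \<H> where A: "subgroup A G" and \<H>: "complete_hall_set \<sigma> G \<H>"
      and perm: "\<forall>H\<in>\<H>. \<forall>x\<in>carrier G. A <#> conjugate G x H = conjugate G x H <#> A"
      unfolding sigma_quasinormal_conjugate by blast
    have "\<exists>Q. Hall_sub G (carrier G) s Q \<and>
      (\<forall>x\<in>carrier G. A <#> conjugate G x Q = conjugate G x Q <#> A)" if s: "s \<in> sig \<sigma> (order G)" for s
    proof -
      obtain Q where "Q \<in> \<H>" "hall_Pi \<sigma> G {s} Q"
        using \<H> s unfolding complete_hall_set_def by metis
      then show ?thesis using perm hall[OF sig[OF s]] by metis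
    qed
    then show "subgroup A G \<and>
    (\<forall>s\<in>sig \<sigma> (order G). \<exists>Q. Hall_sub G (carrier G) s Q \<and>
      (\<forall>x\<in>carrier G. A <#> conjugate G x Q = conjugate G x Q <#> A))" using A by blast
  next
    assume *: "subgroup A G \<and>
    (\<forall>s\<in>sig \<sigma> (order G). \<exists>Q. Hall_sub G (carrier G) s Q \<and>
      (\<forall>x\<in>carrier G. A <#> conjugate G x Q = conjugate G x Q <#> A))"
    then obtain f where f: "\<And>s. s \<in> sig \<sigma> (order G) \<Longrightarrow> Hall_sub G (carrier G) s (f s)"
      and perm: "\<And>s x. s \<in> sig \<sigma> (order G) \<Longrightarrow> x \<in> carrier G \<Longrightarrow>
        A <#> conjugate G x (f s) = conjugate G x (f s) <#> A" by metis
    \<comment> \<open>If the subgroup chosen for \<open>t\<close> were also a Hall subgroup for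
      another block \<open>s\<close>, its order would be 1, and then no prime of \<open>s\<close>
      would divide the order of the group.\<close>
    have uniq: "s = t" if s: "s \<in> sig \<sigma> (order G)" and t: "t \<in> sig \<sigma> (order G)"
      and H: "Hall_sub G (carrier G) s (f t)" for s t
    proof (rule ccontr)
      assume "s \<noteq> t"
      then have disj: "s \<inter> t = {}" using disjointD[OF partition_onD2[OF part]] sig s t by blast
      have "card (f t) = 1"
        using f[OF t] H pi_number_eq_1[of s _ t] disj unfolding Hall_sub_def by blast
      then have "pi_number (- s) (order G)" using H unfolding Hall_sub_def order_def by simp
      then show False using s mem_sig_iff[OF _ sig[OF s]] fin order_gt_0_iff_finite by blast
    qed
    have "complete_hall_set \<sigma> G (f ` sig \<sigma> (order G))"
      unfolding complete_hall_set_def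
    proof (intro conjI ballI impI)
      fix H assume "H \<in> f ` sig \<sigma> (order G)"
      then show "subgroup H G" using f unfolding Hall_sub_def by blast
    next
      fix H assume "H \<in> f ` sig \<sigma> (order G)"
      then show "\<exists>s\<in>\<sigma>. hall_Pi \<sigma> G {s} H" using f hall sig by blast
    next
      fix s assume s: "s \<in> sig \<sigma> (order G)"
      show "\<exists>!H. H \<in> f ` sig \<sigma> (order G) \<and> hall_Pi \<sigma> G {s} H"
        using f[OF s] s uniq[OF s] hall[OF sig[OF s]] by blast
    qed
    moreover have "\<forall>H\<in>f ` sig \<sigma> (order G). \<forall>x\<in>carrier G. A <#> conjugate G x H = conjugate G x H <#> A"
      using perm by simp
    ultimately have "\<exists>\<H>. complete_hall_set \<sigma> G \<H> \<and>
        (\<forall>H\<in>\<H>. \<forall>x\<in>carrier G. A <#> conjugate G x H = conjugate G x H <#> A)"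
      by (intro exI[of _ "f ` sig \<sigma> (order G)"] conjI)
    then show "sigma_quasinormal \<sigma> G A"
      unfolding sigma_quasinormal_conjugate using conjunct1[OF *] by blast
  qed
qed

end

section \<open>Cores and groups of Sylow type\<close>

context fin_group begin

lemma trivial_if_pi_number_compl:
  assumes "subgroup E G" "pi_number (- s) (card E)" "subgroup P G" "P \<subseteq> E" "pi_number s (card P)"
  shows "P = {\<one>}"
proof -
  have "card P = 1"
    using pi_number_eq_1[of s "card P" "- s"] assms(5) pi_number_dvd[OF assms(2) card_subgroup_dvd[OF assms(3,1,4)]]
    by simp
  then show ?thesis using subgroup.one_closed[OF assms(3)] by (metis card_1_singletonE singletonD)
qed

lemma set_mult_one_commute:
  assumes "A \<subseteq> carrier G"
  shows "A <#> {\<one>} = {\<one>} <#> A"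
  using r_coset_eq_set_mult[of G A \<one>] l_coset_eq_set_mult[of G \<one> A] lcos_mult_one[OF assms] coset_mult_one[OF assms]
  by simp

text \<open>The core with the operations of the ambient group; \<open>core_restrict\<close> connects
  it with \<open>core\<close>.\<close>

definition Core :: "'a set \<Rightarrow> 'a set \<Rightarrow> 'a set" where
  "Core U K = (\<Inter>x\<in>U. conjugate G x K)"

lemma core_restrict: "subgroup U G \<Longrightarrow> core (G\<lparr>carrier := U\<rparr>) K = Core U K"
  using conjugate_restrict[of U _ K] unfolding core_def Core_def conjugate_def by simp

lemma subset_conjugate:
  assumes "P \<subseteq> carrier G" "x \<in> carrier G" "conjugate G (inv x) P \<subseteq> K" "K \<subseteq> carrier G"
  shows "P \<subseteq> conjugate G x K"
proof -
  have "conjugate G x (conjugate G (inv x) P) \<subseteq> conjugate G x K" using assms(3) by (rule conjugate_mono)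
  then show ?thesis using assms by (simp add: conjugate_conjugate conjugate_one)
qed

context
  fixes U K
  assumes U: "subgroup U G" and K: "subgroup K G" "K \<subseteq> U"
begin

lemma subgroup_Core: "subgroup (Core U K) G"
  unfolding Core_def
proof (rule subgroups_Inter)
  show "subgroup H G" if "H \<in> (\<lambda>x. conjugate G x K) ` U" for H
    using that subgroup_conjugate[OF K(1)] subgroup.mem_carrier[OF U] by auto
  show "(\<lambda>x. conjugate G x K) ` U \<noteq> {}" using subgroup.one_closed[OF U] by auto
qed

lemma Core_subset: "Core U K \<subseteq> K"
  unfolding Core_def using subgroup.one_closed[OF U] conjugate_one[OF subgroup.subset[OF K(1)]] by blast

lemma subset_Core:
  assumes L: "subgroup L G" "L \<subseteq> K" and norm: "\<And>x. x \<in> U \<Longrightarrow> conjugate G x L \<subseteq> K"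
  shows "L \<subseteq> Core U K"
  unfolding Core_def
proof (rule INT_greatest)
  fix x assume x: "x \<in> U"
  show "L \<subseteq> conjugate G x K"
    using norm[of "inv x"] x subgroup.mem_carrier[OF U] subgroup.m_inv_closed[OF U]
      subset_conjugate[of L x K] subgroup.subset[OF L(1)] subgroup.subset[OF K(1)] by simp
qed

text \<open>Conjugation by \<open>x\<close> only permutes the conjugates that are intersected: the
  one by \<open>y\<close> comes from the one by \<open>y \<otimes> inv x\<close>.\<close>

lemma conjugate_Core:
  assumes x: "x \<in> U"
  shows "conjugate G x (Core U K) \<subseteq> Core U K"
  unfolding Core_def
proof (rule INT_greatest)
  fix y assume y: "y \<in> U"
  have c: "x \<in> carrier G" "y \<in> carrier G" "y \<otimes> inv x \<in> U" "K \<subseteq> carrier G"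
    using x y subgroup.mem_carrier[OF U] subgroup.m_closed[OF U] subgroup.m_inv_closed[OF U] subgroup.subset[OF K(1)]
    by auto
  have "conjugate G x (\<Inter>x\<in>U. conjugate G x K) \<subseteq> conjugate G x (conjugate G (y \<otimes> inv x) K)"
    by (rule conjugate_mono) (use c(3) in blast)
  also have "\<dots> = conjugate G y K"
    using c by (simp add: conjugate_conjugate m_assoc)
  finally show "conjugate G x (\<Inter>x\<in>U. conjugate G x K) \<subseteq> conjugate G y K" .
qed

text \<open>Sylow's theorem provides a subgroup \<open>P\<close> of \<open>U\<close> whose order is
  the full p-part of |U|. Its conjugates in \<open>U\<close> are p-groups too and lie in
  \<open>K\<close>, so \<open>P\<close> lies in the core. Read contrapositively, a prime dividing
  the index of the core yields a p-subgroup of \<open>U\<close> outside \<open>K\<close>.\<close>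

lemma not_dvd_index_Core:
  assumes p: "Factorial_Ring.prime p"
    and sub: "\<And>P. subgroup P G \<Longrightarrow> P \<subseteq> U \<Longrightarrow> pi_number {p} (card P) \<Longrightarrow> P \<subseteq> K"
  shows "\<not> p dvd card U div card (Core U K)"
proof -
  have "card U \<noteq> 0" using card_subgroup_pos[OF U] by simp
  then obtain m where m: "card U = p ^ multiplicity p (card U) * m" "\<not> p dvd m"
    using multiplicity_decompose'[of "card U" p] p not_prime_unit by metis
  then have "\<exists>P. subgroup P (G\<lparr>carrier := U\<rparr>) \<and> card P = p ^ multiplicity p (card U)"
    using sylow_thm[OF p subgroup_imp_group[OF U]] finite_subgroup[OF U] by (simp add: order_def)
  then obtain P where P: "subgroup P G" "P \<subseteq> U" "card P = p ^ multiplicity p (card U)"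
    using subgroup_restrict_iff[OF U] by blast
  have pP: "pi_number {p} (card P)"
    using p P(3) unfolding pi_number_def by (metis prime_dvd_power primes_dvd_imp_eq singletonI)
  have "conjugate G x P \<subseteq> K" if x: "x \<in> U" for x
    using sub[of "conjugate G x P"] pP subgroup_conjugate[OF P(1)] conjugate_subset[OF U P(2) x]
      card_conjugate[OF subgroup.subset[OF P(1)]] subgroup.mem_carrier[OF U x] by simp
  then have "P \<subseteq> Core U K" using subset_Core[OF P(1)] sub[OF P(1,2) pP] by blast
  then have "card P dvd card (Core U K)" by (rule card_subgroup_dvd[OF P(1) subgroup_Core])
  then obtain c where c: "card (Core U K) = card P * c" by (rule dvdE)
  have "card (Core U K) dvd card U"
    using card_subgroup_dvd[OF subgroup_Core U] Core_subset K(2) by blast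
  then obtain d where d: "card U = card (Core U K) * d" by (rule dvdE)
  have "card P * m = card U" unfolding P(3) by (rule m(1)[symmetric])
  also have "\<dots> = card P * (c * d)" using d unfolding c by (simp only: mult.assoc)
  finally have "card P * m = card P * (c * d)" .
  then have "m = c * d" using card_subgroup_pos[OF P(1)] by simp
  moreover have "card U div card (Core U K) = d" using d card_subgroup_pos[OF subgroup_Core] by simp
  ultimately show ?thesis using m(2) by (metis dvd_mult)
qed

end

end

section \<open>Hall subgroups for the blocks and permutability with all of them\<close>

locale sylow_type = fin_group +
  fixes \<sigma> :: "nat set set"
  assumes part: "partition_on all_primes \<sigma>"
    and full: "sigma_full_Sylow \<sigma> G"
begin

lemma disjoint_blocks: "s \<in> \<sigma> \<Longrightarrow> t \<in> \<sigma> \<Longrightarrow> s \<noteq> t \<Longrightarrow> s \<inter> t = {}"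
  using disjointD[OF partition_onD2[OF part]] .

text \<open>\<open>sigma_full_Sylow\<close> covers the blocks meeting the prime divisors of |E|. For
  any other block \<open>E\<close> has no nontrivial s-subgroup, and the trivial subgroup serves;
  thus later arguments can range over all blocks uniformly.\<close>

lemma Hall_dominating:
  assumes E: "subgroup E G" and s: "s \<in> \<sigma>"
  shows "\<exists>Q. Hall_sub G E s Q \<and> (\<forall>P. subgroup P G \<longrightarrow> P \<subseteq> E \<longrightarrow> pi_number s (card P) \<longrightarrow>
    (\<exists>x\<in>E. P \<subseteq> conjugate G x Q))"
proof (cases "s \<in> sig \<sigma> (card E)")
  case True
  let ?E = "G\<lparr>carrier := E\<rparr>"
  have "D_pi ?E s" using full E True unfolding sigma_full_Sylow_def by simp
  then obtain Q where Q: "hall_primes ?E s Q"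
    and dom: "\<forall>P. subgroup P ?E \<and> prime_factors (card P) \<subseteq> s \<longrightarrow> (\<exists>x\<in>carrier ?E. P \<subseteq> conjugate ?E x Q)"
    unfolding D_pi_def conjugate_def by auto
  have "Hall_sub G E s Q"
    using Q fin_group.hall_primes_iff[OF fin_group_subgroup[OF E]] Hall_sub_restrict[OF E subset_refl] by simp
  moreover have "\<exists>x\<in>E. P \<subseteq> conjugate G x Q" if "subgroup P G" "P \<subseteq> E" "pi_number s (card P)" for P
  proof -
    have "subgroup P ?E" "prime_factors (card P) \<subseteq> s"
      using that subgroup_restrict_iff[OF E] prime_factors_subset_iff[OF card_subgroup_pos[OF that(1)]] by auto
    then obtain x where "x \<in> E" "P \<subseteq> conjugate ?E x Q" using dom by auto
    then show ?thesis using conjugate_restrict[OF E] by auto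
  qed
  ultimately show ?thesis by blast
next
  case False
  then have *: "pi_number (- s) (card E)" using mem_sig_iff[OF card_subgroup_pos[OF E] s] by simp
  have "Hall_sub G E s {\<one>}"
    using triv_subgroup subgroup.one_closed[OF E] * unfolding Hall_sub_def by simp
  moreover have "P \<subseteq> conjugate G \<one> {\<one>}" if "subgroup P G" "P \<subseteq> E" "pi_number s (card P)" for P
    using trivial_if_pi_number_compl[OF E * that] by (simp add: conjugate_one)
  ultimately show ?thesis using subgroup.one_closed[OF E] by blast
qed

text \<open>Each Hall subgroup lies in a conjugate of the dominating one \<open>S\<close> and equals
  it by maximality; two conjugates of \<open>S\<close> are conjugate to each other.\<close>

lemma Hall_conjugate:
  assumes E: "subgroup E G" and s: "s \<in> \<sigma>" and Q: "Hall_sub G E s Q" and R: "Hall_sub G E s R"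
  shows "\<exists>x\<in>E. R = conjugate G x Q"
proof -
  obtain S where S: "Hall_sub G E s S"
    and dom: "\<And>P. subgroup P G \<Longrightarrow> P \<subseteq> E \<Longrightarrow> pi_number s (card P) \<Longrightarrow> \<exists>x\<in>E. P \<subseteq> conjugate G x S"
    using Hall_dominating[OF E s] by blast
  have *: "\<exists>x\<in>E. T = conjugate G x S" if T: "Hall_sub G E s T" for T
  proof -
    obtain x where x: "x \<in> E" "T \<subseteq> conjugate G x S" using dom[of T] T unfolding Hall_sub_def by blast
    have "Hall_sub G E s (conjugate G x S)" by (rule Hall_sub_conjugate[OF E S x(1)])
    then have "T = conjugate G x S"
      using Hall_sub_maximal[OF E T _ _ x(2)] unfolding Hall_sub_def by blast
    then show ?thesis using x by blast
  qed
  obtain x y where xy: "x \<in> E" "y \<in> E" "Q = conjugate G x S" "R = conjugate G y S"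
    using *[OF Q] *[OF R] by blast
  have c: "x \<in> carrier G" "y \<in> carrier G" "S \<subseteq> carrier G" "inv x \<otimes> y \<in> E"
    using xy E S subgroup.mem_carrier subgroup.subset subgroup.m_closed subgroup.m_inv_closed
    unfolding Hall_sub_def by metis+
  then have "R = conjugate G (inv x \<otimes> y) Q"
    using xy by (simp add: conjugate_conjugate)
  then show ?thesis using c by blast
qed

lemma Hall_containing:
  assumes E: "subgroup E G" and s: "s \<in> \<sigma>" and P: "subgroup P G" "P \<subseteq> E" "pi_number s (card P)"
  obtains Q where "Hall_sub G E s Q" "P \<subseteq> Q"
  using Hall_dominating[OF E s] P Hall_sub_conjugate[OF E] by metis

text \<open>A form of quasinormality without choices: all Hall subgroups for all blocks are tested.
  By \<open>Hall_conjugate\<close> nothing changes, as \<open>quasinormal_iff_permutable\<close>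
  shows.\<close>

definition permutable :: "'a set \<Rightarrow> 'a set \<Rightarrow> bool" where
  "permutable E A \<longleftrightarrow> subgroup A G \<and> A \<subseteq> E \<and>
    (\<forall>s\<in>\<sigma>. \<forall>Q. Hall_sub G E s Q \<longrightarrow> A <#> Q = Q <#> A)"

lemma quasinormal_iff_permutable:
  assumes E: "subgroup E G"
  shows "sigma_quasinormal \<sigma> (G\<lparr>carrier := E\<rparr>) A \<longleftrightarrow> permutable E A"
proof -
  have *: "sigma_quasinormal \<sigma> (G\<lparr>carrier := E\<rparr>) A \<longleftrightarrow> subgroup A G \<and> A \<subseteq> E \<and>
    (\<forall>s\<in>sig \<sigma> (card E). \<exists>Q. Hall_sub G E s Q \<and>
      (\<forall>x\<in>E. A <#> conjugate G x Q = conjugate G x Q <#> A))"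
    unfolding fin_group.sigma_quasinormal_iff[OF fin_group_subgroup[OF E] part]
    by (simp add: subgroup_restrict_iff[OF E] order_def Hall_sub_restrict[OF E] conjugate_restrict[OF E] conj_assoc)
  show ?thesis
  proof
    assume q: "sigma_quasinormal \<sigma> (G\<lparr>carrier := E\<rparr>) A"
    have "A <#> Q = Q <#> A" if s: "s \<in> \<sigma>" and Q: "Hall_sub G E s Q" for s Q
    proof (cases "s \<in> sig \<sigma> (card E)")
      case True
      then obtain R where R: "Hall_sub G E s R" "\<And>x. x \<in> E \<Longrightarrow> A <#> conjugate G x R = conjugate G x R <#> A"
        using q * by meson
      then show ?thesis using Hall_conjugate[OF E s R(1) Q] by metis
    next
      \<comment> \<open>Blocks outside \<open>sig\<close> are tested by \<open>permutable\<close>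
        alone; their Hall subgroup is trivial.\<close>
      case False
      then have "pi_number (- s) (card E)" using mem_sig_iff[OF card_subgroup_pos[OF E] s] by simp
      then have "Q = {\<one>}" using trivial_if_pi_number_compl[OF E] Q unfolding Hall_sub_def by blast
      moreover have "A \<subseteq> carrier G" using q * subgroup.subset by blast
      ultimately show ?thesis using set_mult_one_commute by simp
    qed
    then show "permutable E A" using q * unfolding permutable_def by blast
  next
    assume p: "permutable E A"
    have "\<exists>Q. Hall_sub G E s Q \<and> (\<forall>x\<in>E. A <#> conjugate G x Q = conjugate G x Q <#> A)"
      if "s \<in> sig \<sigma> (card E)" for s
    proof -
      have s: "s \<in> \<sigma>" using that unfolding sig_def by simp
      obtain Q where "Hall_sub G E s Q" using Hall_dominating[OF E s] by blast
      then show ?thesis using p s Hall_sub_conjugate[OF E] unfolding permutable_def by metis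
    qed
    then show "sigma_quasinormal \<sigma> (G\<lparr>carrier := E\<rparr>) A"
      using * p unfolding permutable_def by blast
  qed
qed

text \<open>Take a Hall s-subgroup \<open>Q\<close> of \<open>E\<close> above \<open>P\<close>. The
  subgroup AQ has s-index over \<open>A\<close>, hence so has its intersection with
  \<open>B\<close>; but |B:A| is an s'-number. So this intersection, which contains
  \<open>P\<close>, is \<open>A\<close> itself.\<close>

lemma subset_if_permutes:
  assumes E: "subgroup E G" and A: "subgroup A G" and B: "subgroup B G" "A \<subseteq> B" "B \<subseteq> E" and s: "s \<in> \<sigma>"
    and perm: "\<And>Q. Hall_sub G E s Q \<Longrightarrow> A <#> Q = Q <#> A"
    and index: "pi_number (- s) (card B div card A)"
    and P: "subgroup P G" "P \<subseteq> B" "pi_number s (card P)"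
  shows "P \<subseteq> A"
proof -
  obtain Q where Q: "Hall_sub G E s Q" "P \<subseteq> Q"
    using Hall_containing[OF E s P(1) _ P(3)] P(2) B(3) by blast
  have Qs: "subgroup Q G" "pi_number s (card Q)" using Q(1) unfolding Hall_sub_def by auto
  have AQ: "subgroup (A <#> Q) G" using subgroup_set_mult[OF A Qs(1) perm[OF Q(1)]] .
  define C where "C = (A <#> Q) \<inter> B"
  have C: "subgroup C G" "A \<subseteq> C" "C \<subseteq> B" "C \<subseteq> A <#> Q"
    using subgroups_Inter_pair[OF AQ B(1)] subset_set_mult(1)[OF A Qs(1)] B(2) unfolding C_def by auto
  have "pi_number s (card (A <#> Q) div card A)"
  proof -
    have "card Q div card (A \<inter> Q) dvd card Q"
      using index_dvd[OF subgroups_Inter_pair[OF A Qs(1)] Qs(1)] by simp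
    then show ?thesis using index_set_mult[OF A Qs(1)] pi_number_dvd[OF Qs(2)] by simp
  qed
  then have "pi_number s (card C div card A)"
    using index_mult[OF A C(1) AQ C(2,4)] by (simp add: pi_number_mult)
  moreover have "pi_number (- s) (card C div card A)"
    using index index_mult[OF A C(1) B(1) C(2,3)] by (simp add: pi_number_mult)
  ultimately have "card C div card A = 1" using pi_number_eq_1[of s _ "- s"] by blast
  then have "A = C" by (rule index_eq_1[OF A C(1,2)])
  then show ?thesis
    using Q(2) P(2) subset_set_mult(2)[OF A Qs(1)] unfolding C_def by blast
qed

end

section \<open>Permutable subgroups are subnormal\<close>

lemma (in fin_group) order_Mod:
  assumes "N \<lhd> G"
  shows "order (G Mod N) = order G div card N"
proof -
  have "subgroup N G" using assms by (rule normal_imp_subgroup)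
  then have "card (rcosets N) * card N = order G" "0 < card N" using lagrange card_subgroup_pos by auto
  then have "card (rcosets N) = order G div card N" by (metis div_mult_self_is_m)
  moreover have "carrier (G Mod N) = rcosets N" by (simp add: FactGroup_def)
  ultimately show ?thesis unfolding order_def[of "G Mod N"] by simp
qed

lemma sigma_subnormal_trans:
  assumes "sigma_subnormal \<sigma> (G\<lparr>carrier := B\<rparr>) A" "sigma_subnormal \<sigma> (G\<lparr>carrier := E\<rparr>) B"
  shows "sigma_subnormal \<sigma> (G\<lparr>carrier := E\<rparr>) A"
  using assms(1)
proof (induction rule: sigma_subnormal.induct)
  case top
  then show ?case using assms(2) by simp
next
  case (step C A)
  \<comment> \<open>Of two successive carrier updates only the last counts, so a step of the chain
    inside \<open>B\<close> is literally a step inside \<open>E\<close>.\<close>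
  have eq: "\<And>F. G\<lparr>carrier := F\<rparr>\<lparr>carrier := C\<rparr> = G\<lparr>carrier := C\<rparr>" by simp
  show ?case
    by (rule sigma_subnormal.step[OF step.IH step.hyps(2,3)[unfolded eq, folded eq[of E]]])
qed

context sylow_type begin

lemma block_of_prime:
  assumes "Factorial_Ring.prime p"
  obtains s where "s \<in> \<sigma>" "p \<in> s"
proof -
  have "p \<in> all_primes" using assms unfolding all_primes_def by simp
  then have "p \<in> \<Union>\<sigma>" unfolding partition_onD1[OF part, symmetric] .
  then show ?thesis using that by blast
qed

text \<open>A Hall s-subgroup \<open>Q\<close> of \<open>F\<close> extends to a Hall s-subgroup
  \<open>R\<close> of \<open>E\<close>, and maximality gives Q = R \<inter> F. Dedekind's law cuts
  AR = RA down to \<open>F\<close>.\<close>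

lemma permutable_restrict:
  assumes E: "subgroup E G" and F: "subgroup F G" "F \<subseteq> E" "A \<subseteq> F" and A: "permutable E A"
  shows "permutable F A"
proof -
  have sA: "subgroup A G" using A unfolding permutable_def by simp
  have "A <#> Q = Q <#> A" if s: "s \<in> \<sigma>" and Q: "Hall_sub G F s Q" for s Q
  proof -
    have Q': "subgroup Q G" "Q \<subseteq> F" "pi_number s (card Q)" using Q unfolding Hall_sub_def by auto
    obtain R where R: "Hall_sub G E s R" "Q \<subseteq> R"
      using Hall_containing[OF E s Q'(1) _ Q'(3)] Q'(2) F(2) by blast
    have R': "subgroup R G" "pi_number s (card R)" using R unfolding Hall_sub_def by auto
    have RF: "subgroup (R \<inter> F) G" by (rule subgroups_Inter_pair[OF R'(1) F(1)])
    have "Q = R \<inter> F"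
      using Hall_sub_maximal[OF F(1) Q RF] R(2) Q'(2)
        pi_number_dvd[OF R'(2) card_subgroup_dvd[OF RF R'(1)]] by simp
    moreover have "A <#> R = R <#> A" using A s R(1) unfolding permutable_def by simp
    ultimately show ?thesis using set_mult_modular[OF sA F(1,3) subgroup.subset[OF R'(1)]] by simp
  qed
  then show ?thesis using sA F(3) unfolding permutable_def by simp
qed

text \<open>A generator from \<open>M\<close> or \<open>N\<close> can be moved past \<open>Q\<close>
  at the cost of changing the element of \<open>Q\<close>. Induction over products of generators
  gives one inclusion, and finiteness the other.\<close>

lemma permutable_generate:
  assumes E: "subgroup E G" and M: "permutable E M" and N: "permutable E N"
  shows "permutable E (generate G (M \<union> N))"
proof -
  let ?J = "generate G (M \<union> N)"
  have sub: "subgroup M G" "M \<subseteq> E" "subgroup N G" "N \<subseteq> E"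
    using M N unfolding permutable_def by auto
  have MN: "M \<union> N \<subseteq> carrier G" using subgroup.subset[OF sub(1)] subgroup.subset[OF sub(3)] by simp
  have J: "subgroup ?J G" by (rule generate_is_subgroup[OF MN])
  have "?J <#> Q = Q <#> ?J" if s: "s \<in> \<sigma>" and Q: "Hall_sub G E s Q" for s Q
  proof (rule set_mult_commute_if_subset[OF J])
    show sQ: "subgroup Q G" using Q unfolding Hall_sub_def by simp
    have MQ: "M <#> Q = Q <#> M" "N <#> Q = Q <#> N" using M N s Q unfolding permutable_def by auto
    have Qc: "q \<in> carrier G" if "q \<in> Q" for q using that subgroup.mem_carrier[OF sQ] by simp
    have Jc: "j \<in> carrier G" if "j \<in> ?J" for j using that subgroup.mem_carrier[OF J] by simp
    have gen: "g \<otimes> q \<in> Q <#> ?J" if g: "g \<in> M \<union> N" and q: "q \<in> Q" for g q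
    proof -
      have "g \<otimes> q \<in> (Q <#> M) \<union> (Q <#> N)"
        using g q by (auto intro: set_mult_memI simp flip: MQ)
      moreover have "Q <#> M \<subseteq> Q <#> ?J" "Q <#> N \<subseteq> Q <#> ?J"
        by (rule mono_set_mult; auto intro: generate.incl)+
      ultimately show ?thesis by blast
    qed
    have "\<forall>q\<in>Q. g \<otimes> q \<in> Q <#> ?J" if "g \<in> ?J" for g
      using that
    proof (induction rule: generate.induct)
      case one
      show ?case
        using subset_set_mult(1)[OF sQ J] Qc by (auto simp: subset_iff)
    next
      case (incl h)
      then show ?case using gen by simp
    next
      case (inv h)
      then have "inv h \<in> M \<union> N" using subgroup.m_inv_closed[OF sub(1)] subgroup.m_inv_closed[OF sub(3)] by auto
      then show ?case using gen by simp
    next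
      case (eng h1 h2)
      show ?case
      proof
        fix q assume q: "q \<in> Q"
        obtain q1 j1 where 1: "q1 \<in> Q" "j1 \<in> ?J" "h2 \<otimes> q = q1 \<otimes> j1"
          using bspec[OF eng.IH(2) q] by (rule set_mult_memE)
        obtain q2 j2 where 2: "q2 \<in> Q" "j2 \<in> ?J" "h1 \<otimes> q1 = q2 \<otimes> j2"
          using bspec[OF eng.IH(1) 1(1)] by (rule set_mult_memE)
        have c: "h1 \<in> carrier G" "h2 \<in> carrier G" "q \<in> carrier G" "q1 \<in> carrier G" "j1 \<in> carrier G"
          "q2 \<in> carrier G" "j2 \<in> carrier G"
          using Jc[OF eng.hyps(1)] Jc[OF eng.hyps(2)] Qc[OF q] Qc[OF 1(1)] Jc[OF 1(2)] Qc[OF 2(1)] Jc[OF 2(2)]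
          by auto
        have "h1 \<otimes> h2 \<otimes> q = h1 \<otimes> (h2 \<otimes> q)" using c by (simp add: m_assoc)
        also have "\<dots> = (h1 \<otimes> q1) \<otimes> j1" using c 1(3) by (simp add: m_assoc)
        also have "\<dots> = q2 \<otimes> (j2 \<otimes> j1)" using c 2(3) by (simp add: m_assoc)
        finally show "h1 \<otimes> h2 \<otimes> q \<in> Q <#> ?J"
          using set_mult_memI[OF 2(1) subgroup.m_closed[OF J 2(2) 1(2)], of G] by simp
      qed
    qed
    then show "?J <#> Q \<subseteq> Q <#> ?J" by (auto elim!: set_mult_memE)
  qed
  moreover have "?J \<subseteq> E" using generate_subgroup_incl[of "M \<union> N" E] sub E by simp
  ultimately show ?thesis using J unfolding permutable_def by simp
qed

text \<open>\<open>M\<close> permutes with the conjugate of \<open>Q\<close> by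
  \<open>inv x\<close>, which is again a Hall subgroup; conjugating this equation by
  \<open>x\<close> gives the claim.\<close>

lemma permutable_conjugate:
  assumes E: "subgroup E G" and M: "permutable E M" and x: "x \<in> E"
  shows "permutable E (conjugate G x M)"
proof -
  have sM: "subgroup M G" "M \<subseteq> E" using M unfolding permutable_def by auto
  have xc: "x \<in> carrier G" "inv x \<in> E" using x subgroup.mem_carrier[OF E] subgroup.m_inv_closed[OF E] by auto
  have "conjugate G x M <#> Q = Q <#> conjugate G x M" if s: "s \<in> \<sigma>" and Q: "Hall_sub G E s Q" for s Q
  proof -
    have sQ: "subgroup Q G" using Q unfolding Hall_sub_def by simp
    have c: "Q \<subseteq> carrier G" "M \<subseteq> carrier G" "conjugate G (inv x) Q \<subseteq> carrier G"
      using subgroup.subset[OF sQ] subgroup.subset[OF sM(1)] conjugate_subset[OF subgroup_self, of Q "inv x"] xc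
      by auto
    have "M <#> conjugate G (inv x) Q = conjugate G (inv x) Q <#> M"
      using M s Hall_sub_conjugate[OF E Q xc(2)] unfolding permutable_def by simp
    then have "conjugate G x (M <#> conjugate G (inv x) Q) = conjugate G x (conjugate G (inv x) Q <#> M)" by simp
    then show ?thesis
      using xc c by (simp add: conjugate_set_mult conjugate_conjugate conjugate_one)
  qed
  then show ?thesis
    using subgroup_conjugate[OF sM(1) xc(1)] conjugate_subset[OF E sM(2) x] unfolding permutable_def by simp
qed

text \<open>The normaliser of \<open>M\<close> in \<open>E\<close> contains a Hall s-subgroup for
  every block \<open>s\<close>, so no prime divides its index.\<close>

lemma normalized_if_Hall_normalize:
  assumes E: "subgroup E G" and M: "subgroup M G" "M \<subseteq> E"
    and norm: "\<And>s Q x. s \<in> \<sigma> \<Longrightarrow> Hall_sub G E s Q \<Longrightarrow> x \<in> Q \<Longrightarrow> conjugate G x M \<subseteq> M"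
  shows "\<forall>x\<in>E. conjugate G x M \<subseteq> M"
proof -
  define N where "N = {x \<in> E. conjugate G x M \<subseteq> M}"
  have Ec: "x \<in> carrier G" if "x \<in> E" for x using that subgroup.mem_carrier[OF E] by simp
  have Mc: "M \<subseteq> carrier G" using subgroup.subset[OF M(1)] .
  have N: "subgroup N G"
  proof (rule subgroupI)
    show "N \<subseteq> carrier G" using Ec unfolding N_def by auto
    show "N \<noteq> {}" using subgroup.one_closed[OF E] conjugate_one[OF Mc] unfolding N_def by auto
    show "inv x \<in> N" if "x \<in> N" for x
    proof -
      have x: "x \<in> E" "conjugate G x M \<subseteq> M" "x \<in> carrier G" using that Ec unfolding N_def by auto
      \<comment> \<open>Closure under inverses needs equality; it follows from the inclusion because
        both sets have the same finite size.\<close>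
      have "conjugate G x M = M"
        by (rule card_subset_eq[OF finite_subgroup[OF M(1)] x(2) card_conjugate[OF Mc x(3)]])
      then have "conjugate G (inv x) M = conjugate G (inv x) (conjugate G x M)" by simp
      also have "\<dots> = M" using x Mc by (simp add: conjugate_conjugate conjugate_one)
      finally show ?thesis using subgroup.m_inv_closed[OF E x(1)] unfolding N_def by simp
    qed
    show "x \<otimes> y \<in> N" if "x \<in> N" "y \<in> N" for x y
    proof -
      have xy: "x \<in> E" "conjugate G x M \<subseteq> M" "y \<in> E" "conjugate G y M \<subseteq> M" using that unfolding N_def by auto
      have "conjugate G (x \<otimes> y) M = conjugate G y (conjugate G x M)"
        using conjugate_conjugate[OF Mc Ec[OF xy(1)] Ec[OF xy(3)]] by simp
      also have "\<dots> \<subseteq> M" using conjugate_mono[OF xy(2)] xy(4) by (rule order_trans)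
      finally show ?thesis using subgroup.m_closed[OF E xy(1,3)] unfolding N_def by simp
    qed
  qed
  have NE: "N \<subseteq> E" unfolding N_def by auto
  have "card E div card N = 1"
  proof (rule ccontr)
    assume "card E div card N \<noteq> 1"
    then obtain p where p: "Factorial_Ring.prime p" "p dvd card E div card N" using prime_factor_nat by blast
    obtain s where s: "s \<in> \<sigma>" "p \<in> s" using block_of_prime[OF p(1)] .
    obtain Q where Q: "Hall_sub G E s Q" using Hall_dominating[OF E s(1)] by blast
    have Q': "subgroup Q G" "Q \<subseteq> E" "pi_number (- s) (card E div card Q)" using Q unfolding Hall_sub_def by auto
    have "Q \<subseteq> N" using norm[OF s(1) Q] Q'(2) unfolding N_def by auto
    then have "p dvd card E div card Q" using index_mult[OF Q'(1) N E _ NE] p(2) by simp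
    then show False using Q'(3) p(1) s(2) unfolding pi_number_def by blast
  qed
  then have "N = E" by (rule index_eq_1[OF N E NE])
  then show ?thesis unfolding N_def by blast
qed

text \<open>Supplies one step of a \<sigma>-subnormal chain, built from the top. A maximal proper
  permutable \<open>M\<close> above \<open>A\<close> is taken because it generates \<open>E\<close>
  together with any conjugate not contained in it.\<close>

lemma permutable_overgroup:
  assumes E: "subgroup E G" and A: "permutable E A" "A \<noteq> E"
  shows "\<exists>M. subgroup M G \<and> A \<subseteq> M \<and> M \<subset> E \<and> (M \<lhd> G\<lparr>carrier := E\<rparr> \<or>
    sigma_primary \<sigma> ((G\<lparr>carrier := E\<rparr>) Mod (core (G\<lparr>carrier := E\<rparr>) M)))"
proof -
  define \<M> where "\<M> = {M. permutable E M \<and> A \<subseteq> M \<and> M \<noteq> E}"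
  have "\<M> \<subseteq> Pow E" unfolding \<M>_def permutable_def by auto
  then have "finite \<M>" using finite_subgroup[OF E] finite_subset by blast
  moreover have "A \<in> \<M>" using A unfolding \<M>_def by simp
  ultimately obtain M where "M \<in> \<M>" and max: "\<forall>N\<in>\<M>. M \<subseteq> N \<longrightarrow> M = N"
    using finite_has_maximal2[of \<M> A] by metis
  then have M: "permutable E M" "A \<subseteq> M" "M \<noteq> E" unfolding \<M>_def by auto
  then have sM: "subgroup M G" "M \<subseteq> E" unfolding permutable_def by auto
  have "M \<lhd> G\<lparr>carrier := E\<rparr> \<or> sigma_primary \<sigma> ((G\<lparr>carrier := E\<rparr>) Mod (core (G\<lparr>carrier := E\<rparr>) M))"
  proof (cases "\<forall>x\<in>E. conjugate G x M \<subseteq> M")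
    case True
    then show ?thesis using normal_restrict_iff[OF E] sM by simp
  next
    case False
    then obtain s Q x where s: "s \<in> \<sigma>" and Q: "Hall_sub G E s Q" and x: "x \<in> Q" "\<not> conjugate G x M \<subseteq> M"
      using normalized_if_Hall_normalize[OF E sM] by blast
    have Q': "subgroup Q G" "Q \<subseteq> E" "pi_number s (card Q)" using Q unfolding Hall_sub_def by auto
    have MQ: "subgroup (M <#> Q) G"
      using subgroup_set_mult[OF sM(1) Q'(1)] M(1) s Q unfolding permutable_def by simp
    have sub: "M \<subseteq> M <#> Q" "Q \<subseteq> M <#> Q" by (rule subset_set_mult[OF sM(1) Q'(1)])+
    \<comment> \<open>\<open>J\<close> is permutable and properly contains \<open>M\<close>, so it
      is \<open>E\<close> by maximality; since \<open>x\<close> lies in \<open>Q\<close>, it also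
      lies inside MQ.\<close>
    define J where "J = generate G (M \<union> conjugate G x M)"
    have "permutable E J"
      unfolding J_def using permutable_generate[OF E M(1) permutable_conjugate[OF E M(1)]] x Q' by blast
    moreover have MJ: "M \<union> conjugate G x M \<subseteq> J" unfolding J_def by (auto intro: generate.incl)
    ultimately have "J = E" using bspec[OF max, of J] M(2) x(2) unfolding \<M>_def by auto
    moreover have "conjugate G x M \<subseteq> M <#> Q"
      using conjugate_subset[OF MQ sub(1)] x(1) sub(2) by blast
    then have "J \<subseteq> M <#> Q"
      unfolding J_def using generate_subgroup_incl[OF _ MQ] sub(1) by simp
    moreover have "M <#> Q \<subseteq> E" by (rule set_mult_least[OF E sM(2) Q'(2)])
    ultimately have EMQ: "E = M <#> Q" by simp
    have "pi_number s (card E div card M)"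
      using index_set_mult[OF sM(1) Q'(1)] pi_number_dvd[OF Q'(3) index_dvd[OF subgroups_Inter_pair[OF sM(1) Q'(1)] Q'(1)]]
      unfolding EMQ by simp
    then have index: "pi_number (- t) (card E div card M)" if "t \<in> \<sigma>" "t \<noteq> s" for t
      using disjoint_blocks[OF that(1) s that(2)] by (auto elim!: pi_number_mono)
    have C: "subgroup (Core E M) G" "Core E M \<subseteq> E"
      using subgroup_Core[OF E sM] Core_subset[OF E sM] sM(2) by auto
    have "pi_number s (card E div card (Core E M))"
      unfolding pi_number_def
    proof (intro allI impI)
      fix p assume p: "Factorial_Ring.prime p" "p dvd card E div card (Core E M)"
      obtain t where t: "t \<in> \<sigma>" "p \<in> t" using block_of_prime[OF p(1)] .
      have "t = s"
      proof (rule ccontr)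
        assume ts: "t \<noteq> s"
        \<comment> \<open>As |E:M| is an s-number, \<open>M\<close> absorbs every t-subgroup of
          \<open>E\<close> for t different from s, in particular every p-subgroup.\<close>
        have "P \<subseteq> M" if P: "subgroup P G" "P \<subseteq> E" "pi_number {p} (card P)" for P
        proof (rule subset_if_permutes[OF E sM(1) E sM(2) subset_refl t(1) _ index[OF t(1) ts] P(1,2)])
          show "M <#> Q = Q <#> M" if "Hall_sub G E t Q" for Q
            using M(1) t(1) that unfolding permutable_def by simp
          show "pi_number t (card P)" using P(3) t(2) by (auto elim!: pi_number_mono)
        qed
        then show False using not_dvd_index_Core[OF E sM p(1)] p(2) by blast
      qed
      then show "p \<in> s" using t by simp
    qed
    then have sig: "sig \<sigma> (card E div card (Core E M)) \<subseteq> {s}"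
      using sig_number_iff[OF part, of "{s}"] s index_pos[OF C(1) E C(2)] unfolding sig_number_def by simp
    have "Core E M \<lhd> G\<lparr>carrier := E\<rparr>"
      using normal_restrict_iff[OF E] C conjugate_Core[OF E sM] by simp
    then have "order ((G\<lparr>carrier := E\<rparr>) Mod (Core E M)) = card E div card (Core E M)"
      using fin_group.order_Mod[OF fin_group_subgroup[OF E]] by (simp add: order_def)
    then have "sigma_primary \<sigma> ((G\<lparr>carrier := E\<rparr>) Mod (core (G\<lparr>carrier := E\<rparr>) M))"
      using card_mono[OF _ sig] unfolding sigma_primary_def core_restrict[OF E] by simp
    then show ?thesis ..
  qed
  then show ?thesis using M sM by blast
qed

lemma subgroup_if_sigma_subnormal:
  assumes E: "subgroup E G" and B: "sigma_subnormal \<sigma> (G\<lparr>carrier := E\<rparr>) B"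
  shows "subgroup B G \<and> B \<subseteq> E"
  using B
proof (induction rule: sigma_subnormal.induct)
  case top
  then show ?case using E by simp
next
  case (step B A)
  then show ?case using subgroup_restrict_iff[of B A] by auto
qed

text \<open>Take a minimal \<sigma>-subnormal \<open>B\<close> above \<open>A\<close>. Since
  \<open>A\<close> stays permutable in \<open>B\<close>, a proper inclusion would let
  \<open>permutable_overgroup\<close> produce a smaller one.\<close>

lemma sigma_subnormal_if_permutable:
  assumes E: "subgroup E G" and A: "permutable E A"
  shows "sigma_subnormal \<sigma> (G\<lparr>carrier := E\<rparr>) A"
proof -
  define \<B> where "\<B> = {B. sigma_subnormal \<sigma> (G\<lparr>carrier := E\<rparr>) B \<and> A \<subseteq> B}"
  have sub: "subgroup B G \<and> B \<subseteq> E" if "B \<in> \<B>" for B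
    using that subgroup_if_sigma_subnormal[OF E] unfolding \<B>_def by blast
  then have "finite \<B>" using finite_subset[of \<B> "Pow E"] finite_subgroup[OF E] by blast
  moreover have "E \<in> \<B>"
    using sigma_subnormal.top[of \<sigma> "G\<lparr>carrier := E\<rparr>"] A unfolding \<B>_def permutable_def by simp
  ultimately obtain B where B: "B \<in> \<B>" and min: "\<forall>C\<in>\<B>. C \<subseteq> B \<longrightarrow> B = C"
    using finite_has_minimal2[of \<B> E] by metis
  have sB: "subgroup B G" "B \<subseteq> E" "A \<subseteq> B" "sigma_subnormal \<sigma> (G\<lparr>carrier := E\<rparr>) B"
    using B sub[OF B] unfolding \<B>_def by auto
  have "A = B"
  proof (rule ccontr)
    assume "A \<noteq> B"
    then obtain M where M: "subgroup M G" "A \<subseteq> M" "M \<subset> B" "M \<lhd> G\<lparr>carrier := B\<rparr> \<or>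
        sigma_primary \<sigma> ((G\<lparr>carrier := B\<rparr>) Mod (core (G\<lparr>carrier := B\<rparr>) M))"
      using permutable_overgroup[OF sB(1) permutable_restrict[OF E sB(1-3) A]] by blast
    have "sigma_subnormal \<sigma> (G\<lparr>carrier := E\<rparr>) M"
      by (rule sigma_subnormal.step[OF sB(4)]) (use M subgroup_restrict_iff[OF sB(1)] in auto)
    then have "M \<in> \<B>" using M(2) unfolding \<B>_def by simp
    then show False using min M(3) by blast
  qed
  then show ?thesis using sB by simp
qed

end

section \<open>Homomorphic images\<close>

text \<open>Covers both the projection of G onto G/D and, by \<open>fin_epi_restrict\<close>, its
  restriction to a subgroup with the image as codomain.\<close>

locale fin_epi = group_hom +
  assumes finite_domain: "finite (carrier G)"
    and surj: "h ` carrier G = carrier H"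
begin

lemma fin_group_domain: "fin_group G"
  by (simp add: fin_group_def fin_group_axioms_def G.group_axioms finite_domain)

lemma fin_group_codomain: "fin_group H"
  using finite_imageI[OF finite_domain, of h] surj
  by (simp add: fin_group_def fin_group_axioms_def H.group_axioms)

lemma fin_epi_restrict:
  assumes Q: "subgroup Q G"
  shows "fin_epi (G\<lparr>carrier := Q\<rparr>) (H\<lparr>carrier := h ` Q\<rparr>) h"
proof -
  have "h \<in> hom (G\<lparr>carrier := Q\<rparr>) (H\<lparr>carrier := h ` Q\<rparr>)"
    using subgroup.mem_carrier[OF Q] by (auto simp: hom_def)
  then show ?thesis
    using G.subgroup_imp_group[OF Q] H.subgroup_imp_group[OF subgroup_img_is_subgroup[OF Q]]
      finite_subset[OF subgroup.subset[OF Q] finite_domain]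
    by (simp add: fin_epi_def fin_epi_axioms_def group_hom_def group_hom_axioms_def)
qed

lemma card_codomain: "card (carrier H) * card (kernel G H h) = card (carrier G)"
proof -
  have "card (carrier (G Mod kernel G H h)) = card (carrier H)"
    using iso_same_card[OF FactGroup_iso[OF surj]] .
  then have "card (carrier H) = card (carrier G) div card (kernel G H h)"
    using fin_group.order_Mod[OF fin_group_domain normal_kernel] by (simp add: order_def)
  moreover have "card (kernel G H h) dvd card (carrier G)"
    using fin_group.card_subgroup_dvd[OF fin_group_domain subgroup_kernel G.subgroup_self]
      subgroup.subset[OF subgroup_kernel] by blast
  ultimately show ?thesis by simp
qed

lemma card_image_subgroup:
  assumes Q: "subgroup Q G"
  shows "card (h ` Q) * card (kernel G H h \<inter> Q) = card Q"
proof -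
  have "kernel (G\<lparr>carrier := Q\<rparr>) (H\<lparr>carrier := h ` Q\<rparr>) h = kernel G H h \<inter> Q"
    using subgroup.mem_carrier[OF Q] by (auto simp: kernel_def)
  then show ?thesis using fin_epi.card_codomain[OF fin_epi_restrict[OF Q]] by simp
qed

text \<open>Both arithmetic conditions pass to divisors: |h(Q)| divides |Q|, and |G:Q| is the index
  of h(Q) times the index \<open>r\<close> of the kernel of h on \<open>Q\<close> in the whole
  kernel.\<close>

lemma Hall_image:
  assumes Q: "Hall_sub G (carrier G) s Q"
  shows "Hall_sub H (carrier H) s (h ` Q)"
proof -
  have Q': "subgroup Q G" "pi_number s (card Q)" "pi_number (- s) (card (carrier G) div card Q)"
    using Q unfolding Hall_sub_def by auto
  let ?k = "card (kernel G H h)" and ?l = "card (kernel G H h \<inter> Q)"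
  have l: "subgroup (kernel G H h \<inter> Q) G" by (rule G.subgroups_Inter_pair[OF subgroup_kernel Q'(1)])
  have hQ: "subgroup (h ` Q) H" by (rule subgroup_img_is_subgroup[OF Q'(1)])
  have "?l dvd ?k" by (rule fin_group.card_subgroup_dvd[OF fin_group_domain l subgroup_kernel]) simp
  then obtain r where r: "?k = ?l * r" by (rule dvdE)
  have "card (h ` Q) dvd card (carrier H)"
    using fin_group.card_subgroup_dvd[OF fin_group_codomain hQ H.subgroup_self] subgroup.subset[OF hQ] by blast
  then obtain d where d: "card (carrier H) = card (h ` Q) * d" by (rule dvdE)
  have "card (carrier G) = card (h ` Q) * d * (?l * r)" using card_codomain unfolding d r by simp
  also have "\<dots> = card (h ` Q) * ?l * (d * r)" by (simp only: ac_simps)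
  also have "\<dots> = card Q * (d * r)" using card_image_subgroup[OF Q'(1)] by simp
  finally have "card (carrier G) div card Q = d * r"
    using fin_group.card_subgroup_pos[OF fin_group_domain Q'(1)] by simp
  then have "pi_number (- s) d" using Q'(3) by (simp add: pi_number_mult)
  moreover have "card (carrier H) div card (h ` Q) = d"
    using d fin_group.card_subgroup_pos[OF fin_group_codomain hQ] by simp
  moreover have "pi_number s (card (h ` Q))"
    using Q'(2) unfolding card_image_subgroup[OF Q'(1), symmetric] by (simp add: pi_number_mult)
  ultimately show ?thesis using hQ subgroup.subset[OF hQ] unfolding Hall_sub_def by simp
qed

lemma image_conjugate:
  assumes "x \<in> carrier G" "Q \<subseteq> carrier G"
  shows "h ` conjugate G x Q = conjugate H (h x) (h ` Q)"
  unfolding conjugate_eq_image image_image using assms by (intro image_cong refl) (auto simp: subset_iff)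

text \<open>A block in \<sigma>(H) also belongs to \<sigma>(G). The Hall subgroup given there is
  mapped by \<open>h\<close>, together with its permutability equations; surjectivity reaches all
  conjugating elements.\<close>

lemma quasinormal_image:
  assumes part: "partition_on all_primes \<sigma>" and A: "sigma_quasinormal \<sigma> G A"
  shows "sigma_quasinormal \<sigma> H (h ` A)"
proof -
  note qG = fin_group.sigma_quasinormal_iff[OF fin_group_domain part]
  note qH = fin_group.sigma_quasinormal_iff[OF fin_group_codomain part]
  have sA: "subgroup A G" using A unfolding qG by simp
  have "\<exists>Q. Hall_sub H (carrier H) s Q \<and>
      (\<forall>x\<in>carrier H. h ` A <#>\<^bsub>H\<^esub> conjugate H x Q = conjugate H x Q <#>\<^bsub>H\<^esub> h ` A)"
    if s: "s \<in> sig \<sigma> (order H)" for s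
  proof -
    have s\<sigma>: "s \<in> \<sigma>" using s unfolding sig_def by simp
    have pos: "0 < order H" "0 < order G"
      using H.order_gt_0_iff_finite G.order_gt_0_iff_finite finite_domain fin_group.fin[OF fin_group_codomain] by auto
    have "order H dvd order G" unfolding order_def card_codomain[symmetric] by simp
    then have "s \<in> sig \<sigma> (order G)"
      using s mem_sig_iff[OF pos(1) s\<sigma>] mem_sig_iff[OF pos(2) s\<sigma>] pi_number_dvd by blast
    then obtain Q where Q: "Hall_sub G (carrier G) s Q"
      and perm: "\<forall>x\<in>carrier G. A <#>\<^bsub>G\<^esub> conjugate G x Q = conjugate G x Q <#>\<^bsub>G\<^esub> A"
      using A unfolding qG by metis
    have Qc: "Q \<subseteq> carrier G" using Q unfolding Hall_sub_def by simp
    have "h ` A <#>\<^bsub>H\<^esub> conjugate H y (h ` Q) = conjugate H y (h ` Q) <#>\<^bsub>H\<^esub> h ` A" if y: "y \<in> carrier H" for y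
    proof -
      obtain x where x: "x \<in> carrier G" "y = h x" using y surj by (metis imageE)
      have c: "conjugate G x Q \<subseteq> carrier G"
        by (rule fin_group.conjugate_subset[OF fin_group_domain G.subgroup_self Qc x(1)])
      have "h ` (A <#>\<^bsub>G\<^esub> conjugate G x Q) = h ` (conjugate G x Q <#>\<^bsub>G\<^esub> A)" using perm x(1) by simp
      then show ?thesis
        using set_mult_hom[OF homh subgroup.subset[OF sA] c] set_mult_hom[OF homh c subgroup.subset[OF sA]]
        unfolding x(2) image_conjugate[OF x(1) Qc, symmetric] by simp
    qed
    then show ?thesis using Hall_image[OF Q] by blast
  qed
  then show ?thesis using subgroup_img_is_subgroup[OF sA] unfolding qH by simp
qed

lemma subgroup_preimage:
  assumes T: "subgroup T H"
  shows "subgroup {x \<in> carrier G. h x \<in> T} G"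
  by (rule G.subgroupI)
    (use subgroup.one_closed[OF T] subgroup.m_closed[OF T] subgroup.m_inv_closed[OF T] in auto)

text \<open>Sylow type is assumed for the domain, so conjugacy in the image is obtained there. The
  preimage of \<open>T\<close> has the index of \<open>T\<close>; a Hall s-subgroup \<open>R\<close>
  of it is therefore one of G, maps onto \<open>T\<close>, and is conjugate to
  \<open>Q\<close>.\<close>

lemma Hall_image_conjugate:
  assumes st: "sylow_type G \<sigma>" and s: "s \<in> \<sigma>" and Q: "Hall_sub G (carrier G) s Q" and T: "Hall_sub H (carrier H) s T"
  shows "\<exists>x\<in>carrier H. h ` Q = conjugate H x T"
proof -
  interpret S: sylow_type G \<sigma> by (rule st)
  let ?U = "{x \<in> carrier G. h x \<in> T}"
  have T': "subgroup T H" "T \<subseteq> carrier H" "pi_number s (card T)" "pi_number (- s) (card (carrier H) div card T)"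
    using T unfolding Hall_sub_def by auto
  have U: "subgroup ?U G" "?U \<subseteq> carrier G" by (use subgroup_preimage[OF T'(1)] in auto)
  have hU: "h ` ?U = T"
  proof
    show "T \<subseteq> h ` ?U"
    proof
      fix t assume t: "t \<in> T"
      then have "t \<in> h ` carrier G" using T'(2) surj by blast
      then show "t \<in> h ` ?U" using t by auto
    qed
  qed auto
  have "kernel G H h \<inter> ?U = kernel G H h" using subgroup.one_closed[OF T'(1)] by (auto simp: kernel_def)
  then have cU: "card T * card (kernel G H h) = card ?U"
    using card_image_subgroup[OF U(1)] unfolding hU by simp
  have k: "0 < card (kernel G H h)" by (rule S.card_subgroup_pos[OF subgroup_kernel])
  have "card (carrier G) div card ?U = card (carrier H) div card T"
    unfolding cU[symmetric] card_codomain[symmetric] using k by simp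
  then have i1: "pi_number (- s) (card (carrier G) div card ?U)" using T'(4) by simp
  obtain R where R: "Hall_sub G ?U s R" using S.Hall_dominating[OF U(1) s] by blast
  have R': "subgroup R G" "R \<subseteq> ?U" "pi_number s (card R)" "pi_number (- s) (card ?U div card R)"
    using R unfolding Hall_sub_def by auto
  have RG: "Hall_sub G (carrier G) s R"
    using R' i1 S.index_mult[OF R'(1) U(1) G.subgroup_self R'(2) U(2)]
    unfolding Hall_sub_def by (auto simp: pi_number_mult)
  have "h ` R = T"
    by (rule fin_group.Hall_sub_maximal[OF fin_group_codomain H.subgroup_self Hall_image[OF RG] T'(1,2) _ T'(3)])
      (use R'(2) in auto)
  moreover obtain x where x: "x \<in> carrier G" "Q = conjugate G x R"
    using S.Hall_conjugate[OF G.subgroup_self s RG Q] by blast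
  ultimately have "h ` Q = conjugate H (h x) T"
    using image_conjugate[OF x(1) subgroup.subset[OF R'(1)]] by simp
  then show ?thesis using x(1) by auto
qed

end

section \<open>Chains of permutable subgroups\<close>

context fin_group begin

lemma set_mult_commute_if_normalizes:
  assumes "subgroup K G" "subgroup Q G" "\<And>x. x \<in> Q \<Longrightarrow> conjugate G x K \<subseteq> K"
  shows "K <#> Q = Q <#> K"
proof (rule set_mult_commute_if_subset[OF assms(1,2)], rule subsetI)
  fix y assume "y \<in> K <#> Q"
  then obtain k q where kq: "k \<in> K" "q \<in> Q" "y = k \<otimes> q" by (rule set_mult_memE)
  then have c: "k \<in> carrier G" "q \<in> carrier G" using assms subgroup.mem_carrier by metis+
  have "inv q \<otimes> k \<otimes> q \<in> K" using assms(3)[OF kq(2)] kq(1) unfolding conjugate_eq_image by auto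
  moreover have "y = q \<otimes> (inv q \<otimes> k \<otimes> q)" using kq c by (simp add: m_assoc)
  ultimately show "y \<in> Q <#> K" using kq(2) set_mult_memI by metis
qed

lemma normal_conjugate: "D \<lhd> G \<Longrightarrow> x \<in> carrier G \<Longrightarrow> conjugate G x D \<subseteq> D"
  using normal_iff_conjugate[OF normal_imp_subgroup] by blast

lemma normal_commute:
  assumes "D \<lhd> G" "subgroup K G"
  shows "D <#> K = K <#> D"
  using set_mult_commute_if_normalizes[OF normal_imp_subgroup[OF assms(1)] assms(2)]
    normal_conjugate[OF assms(1)] subgroup.mem_carrier[OF assms(2)] by blast

lemma fin_epi_Mod:
  assumes "D \<lhd> G"
  shows "fin_epi G (G Mod D) (\<lambda>x. D #> x)"
  using normal.r_coset_hom_Mod[OF assms] normal.factorgroup_is_group[OF assms] carrier_FactGroup[of G D]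
  by (simp add: fin_epi_def fin_epi_axioms_def group_hom_def group_hom_axioms_def)

text \<open>The index equals |DK:D|, which divides |G:D|.\<close>

lemma index_Int_normal_Hall:
  assumes D: "D \<lhd> G" "pi_number (- \<pi>) (card (carrier G) div card D)" and K: "subgroup K G"
  shows "pi_number (- \<pi>) (card K div card (K \<inter> D))"
proof -
  have sD: "subgroup D G" by (rule normal_imp_subgroup[OF D(1)])
  have DK: "subgroup (D <#> K) G" by (rule subgroup_set_mult[OF sD K normal_commute[OF D(1) K]])
  have "card (D <#> K) div card D = card K div card (K \<inter> D)"
    using index_set_mult[OF sD K] by (simp add: Int_commute)
  then show ?thesis
    using D(2) index_mult[OF sD DK subgroup_self subset_set_mult(1)[OF sD K] subgroup.subset[OF DK]]
    by (simp add: pi_number_mult)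
qed

end

context sylow_type begin

text \<open>For \<open>s\<close> inside \<pi> a Hall s-subgroup of \<open>D\<close> is one of
  \<open>E\<close>, and Dedekind's law restricts the equation AQ = QA to \<open>D\<close>. For
  \<open>s\<close> outside \<pi> it is trivial.\<close>

lemma permutable_Int_Hall:
  assumes E: "subgroup E G" and A: "permutable E A" and D: "Hall_sub G E \<pi> D"
    and blocks: "\<And>s. s \<in> \<sigma> \<Longrightarrow> s \<subseteq> \<pi> \<or> s \<inter> \<pi> = {}"
  shows "permutable D (A \<inter> D)"
proof -
  have sA: "subgroup A G" using A unfolding permutable_def by simp
  have D': "subgroup D G" "D \<subseteq> E" "pi_number \<pi> (card D)" "pi_number (- \<pi>) (card E div card D)"
    using D unfolding Hall_sub_def by auto
  have sAD: "subgroup (A \<inter> D) G" by (rule subgroups_Inter_pair[OF sA D'(1)])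
  have "(A \<inter> D) <#> Q = Q <#> (A \<inter> D)" if s: "s \<in> \<sigma>" and Q: "Hall_sub G D s Q" for s Q
  proof -
    have Q': "subgroup Q G" "Q \<subseteq> D" "pi_number s (card Q)" "pi_number (- s) (card D div card Q)"
      using Q unfolding Hall_sub_def by auto
    show ?thesis
    proof (cases "s \<subseteq> \<pi>")
      case True
      then have "pi_number (- s) (card E div card D)" using D'(4) by (auto elim!: pi_number_mono)
      then have "Hall_sub G E s Q"
        using Q' D'(2) index_mult[OF Q'(1) D'(1) E Q'(2) D'(2)] unfolding Hall_sub_def
        by (auto simp: pi_number_mult)
      then have "A <#> Q = Q <#> A" using A s unfolding permutable_def by blast
      then have "(A <#> Q) \<inter> D = (Q <#> A) \<inter> D" by simp
      then show ?thesis
        using set_mult_modular[OF Q'(1) D'(1) Q'(2) subgroup.subset[OF sA]] by simp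
    next
      case False
      then have "pi_number (- s) (card D)" using blocks[OF s] D'(3) by (auto elim!: pi_number_mono)
      then have "Q = {\<one>}" using trivial_if_pi_number_compl[OF D'(1) _ Q'(1,2,3)] by blast
      then show ?thesis using set_mult_one_commute[OF subgroup.subset[OF sAD]] by simp
    qed
  qed
  then show ?thesis using sAD unfolding permutable_def by simp
qed

text \<open>By \<open>Hall_image_conjugate\<close> the image of any Hall subgroup \<open>Q\<close>
  of G is among those with which the image of \<open>K\<close> permutes. Hence KQ and QK agree
  modulo \<open>D\<close>, and a factor from \<open>D\<close> in KD absorbs the difference.\<close>

lemma permutable_if_quasinormal_Mod:
  assumes D: "D \<lhd> G" and K: "subgroup K G" and q: "sigma_quasinormal \<sigma> (G Mod D) ((\<lambda>x. D #> x) ` K)"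
  shows "permutable (carrier G) (K <#> D)"
proof -
  let ?h = "\<lambda>x. D #> x"
  have sD: "subgroup D G" by (rule normal_imp_subgroup[OF D])
  have epi: "fin_epi G (G Mod D) ?h" by (rule fin_epi_Mod[OF D])
  interpret Mod: fin_group "G Mod D" by (rule fin_epi.fin_group_codomain[OF epi])
  have KD: "subgroup (K <#> D) G" by (rule subgroup_set_mult[OF K sD normal_commute[OF D K, symmetric]])
  have Kc: "K \<subseteq> carrier G" by (rule subgroup.subset[OF K])
  have hK: "subgroup (?h ` K) (G Mod D)"
    using q unfolding Mod.sigma_quasinormal_iff[OF part] by simp
  have hom: "?h \<in> hom G (G Mod D)" by (rule normal.r_coset_hom_Mod[OF D])
  have "(K <#> D) <#> Q = Q <#> (K <#> D)" if s: "s \<in> \<sigma>" and Q: "Hall_sub G (carrier G) s Q" for s Q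
  proof -
    have sQ: "subgroup Q G" "Q \<subseteq> carrier G" using Q unfolding Hall_sub_def by auto
    have hQ: "Hall_sub (G Mod D) (carrier (G Mod D)) s (?h ` Q)" by (rule fin_epi.Hall_image[OF epi Q])
    have "?h ` K <#>\<^bsub>G Mod D\<^esub> ?h ` Q = ?h ` Q <#>\<^bsub>G Mod D\<^esub> ?h ` K"
    proof (cases "s \<in> sig \<sigma> (order (G Mod D))")
      case True
      then obtain T where T: "Hall_sub (G Mod D) (carrier (G Mod D)) s T"
        and perm: "\<forall>x\<in>carrier (G Mod D). ?h ` K <#>\<^bsub>G Mod D\<^esub> conjugate (G Mod D) x T
          = conjugate (G Mod D) x T <#>\<^bsub>G Mod D\<^esub> ?h ` K"
        using q unfolding Mod.sigma_quasinormal_iff[OF part] by metis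
      then show ?thesis
        using fin_epi.Hall_image_conjugate[OF epi sylow_type_axioms s Q T] by metis
    next
      case False
      then have "pi_number (- s) (card (carrier (G Mod D)))"
        using mem_sig_iff[OF _ s] Mod.card_subgroup_pos[OF Mod.subgroup_self] by (simp add: order_def)
      then have "?h ` Q = {\<one>\<^bsub>G Mod D\<^esub>}"
        using Mod.trivial_if_pi_number_compl[OF Mod.subgroup_self] hQ unfolding Hall_sub_def by metis
      then show ?thesis using Mod.set_mult_one_commute[OF subgroup.subset[OF hK]] by simp
    qed
    then have eq: "?h ` (K <#> Q) = ?h ` (Q <#> K)"
      using set_mult_hom[OF hom Kc sQ(2)] set_mult_hom[OF hom sQ(2) Kc] by simp
    have "Q <#> (K <#> D) \<subseteq> (K <#> D) <#> Q"
    proof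
      fix y assume "y \<in> Q <#> (K <#> D)"
      then obtain z x where z: "z \<in> Q" and x: "x \<in> K <#> D" "y = z \<otimes> x" by (rule set_mult_memE)
      obtain k d where kd: "k \<in> K" "d \<in> D" "x = k \<otimes> d" using x(1) by (rule set_mult_memE)
      have c: "z \<in> carrier G" "k \<in> carrier G" "d \<in> carrier G"
        using z kd sQ(2) Kc subgroup.mem_carrier[OF sD] by auto
      \<comment> \<open>Equality of images puts \<open>z \<otimes> k\<close> in KQ up to a left
        factor \<open>e\<close> from \<open>D\<close>.\<close>
      have "?h (z \<otimes> k) \<in> ?h ` (K <#> Q)" using eq set_mult_memI[OF z kd(1), of G] by auto
      then obtain w where w: "w \<in> K <#> Q" "D #> (z \<otimes> k) = D #> w" by blast
      obtain k' q where kq: "k' \<in> K" "q \<in> Q" "w = k' \<otimes> q" using w(1) by (rule set_mult_memE)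
      have c': "k' \<in> carrier G" "q \<in> carrier G" using kq sQ(2) Kc by auto
      have "z \<otimes> k \<in> D #> w" using rcos_self[OF _ sD, of "z \<otimes> k"] c w(2) by simp
      then obtain e where e: "e \<in> D" "z \<otimes> k = e \<otimes> w" unfolding r_coset_def by auto
      have ec: "e \<in> carrier G" using e(1) subgroup.mem_carrier[OF sD] by simp
      \<comment> \<open>Normality of \<open>D\<close> lets \<open>e\<close> pass \<open>k'\<close>
        and \<open>d\<close> pass \<open>q\<close>, so both errors end up in the factor KD.\<close>
      have DK: "D <#> K = K <#> D" and DQ: "D <#> Q = Q <#> D"
        using normal_commute[OF D] K sQ(1) by auto
      have "q \<otimes> d \<in> D <#> Q" using set_mult_memI[OF kq(2) kd(2), of G] DQ by simp
      then obtain f q' where f: "f \<in> D" "q' \<in> Q" "q \<otimes> d = f \<otimes> q'" by (rule set_mult_memE)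
      have fc: "f \<in> carrier G" "q' \<in> carrier G" using f sQ(2) subgroup.mem_carrier[OF sD] by auto
      have "e \<otimes> k' \<in> K <#> D" using set_mult_memI[OF e(1) kq(1), of G] DK by simp
      moreover have "f \<in> K <#> D" using subset_set_mult(2)[OF K sD] f(1) by blast
      ultimately have m: "(e \<otimes> k') \<otimes> f \<in> K <#> D" by (rule subgroup.m_closed[OF KD])
      have "y = (z \<otimes> k) \<otimes> d" using x(2) kd(3) c by (simp add: m_assoc)
      also have "\<dots> = (e \<otimes> k') \<otimes> (q \<otimes> d)" using e(2) kq(3) c c' ec by (simp add: m_assoc)
      also have "\<dots> = ((e \<otimes> k') \<otimes> f) \<otimes> q'" using f(3) c' ec fc by (simp add: m_assoc)
      finally show "y \<in> (K <#> D) <#> Q" using set_mult_memI[OF m f(2), of G] by simp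
    qed
    then show ?thesis using set_mult_commute_if_subset[OF sQ(1) KD] by simp
  qed
  then show ?thesis using KD subgroup.subset[OF KD] unfolding permutable_def by simp
qed

end

text \<open>The situation for one pair \<open>H\<close>, \<open>K\<close>:
  \<open>subnormal_D\<close> is hypothesis (ii), \<open>permutable_KD\<close> is what hypothesis (i)
  contributes, and \<open>blocks\<close> says that \<pi> does not split any block.\<close>

locale hall_chain = sylow_type +
  fixes D \<pi> H K
  assumes normal_D: "D \<lhd> G"
    and Hall_D: "Hall_sub G (carrier G) \<pi> D"
    and blocks: "\<And>s. s \<in> \<sigma> \<Longrightarrow> s \<subseteq> \<pi> \<or> s \<inter> \<pi> = {}"
    and subnormal_D: "\<And>A. sigma_subnormal \<sigma> (G\<lparr>carrier := D\<rparr>) A \<Longrightarrow> A \<lhd> G"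
    and permutable_H: "permutable (carrier G) H"
    and permutable_K: "permutable H K"
    and permutable_KD: "permutable (carrier G) (K <#> D)"
begin

lemma sub_D: "subgroup D G" by (rule normal_imp_subgroup[OF normal_D])

lemma sub_H: "subgroup H G" using permutable_H unfolding permutable_def by simp

lemma sub_K: "subgroup K G" "K \<subseteq> H" using permutable_K unfolding permutable_def by auto

lemma pi_D: "pi_number \<pi> (card D)" "pi_number (- \<pi>) (card (carrier G) div card D)"
  using Hall_D unfolding Hall_sub_def by auto

lemma sub_KD: "subgroup (K <#> D) G" using permutable_KD unfolding permutable_def by simp

lemma H_Int_D_subnormal: "sigma_subnormal \<sigma> (G\<lparr>carrier := D\<rparr>) (H \<inter> D)"
  by (rule sigma_subnormal_if_permutable[OF sub_D permutable_Int_Hall[OF subgroup_self permutable_H Hall_D blocks]])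

lemma pi_Int_D:
  assumes "subgroup A G"
  shows "pi_number \<pi> (card (A \<inter> D))"
  by (rule pi_number_dvd[OF pi_D(1) card_subgroup_dvd[OF subgroups_Inter_pair[OF assms sub_D] sub_D]]) simp

text \<open>\<open>H \<inter> D\<close> is a Hall subgroup of \<open>H\<close>, so
  \<open>permutable_Int_Hall\<close> applies at both levels of the chain; transitivity of
  \<sigma>-subnormality joins the results.\<close>

lemma K_Int_D_normal: "K \<inter> D \<lhd> G"
proof -
  have sHD: "subgroup (H \<inter> D) G" by (rule subgroups_Inter_pair[OF sub_H sub_D])
  have "Hall_sub G H \<pi> (H \<inter> D)"
    using sHD pi_Int_D[OF sub_H] index_Int_normal_Hall[OF normal_D pi_D(2) sub_H] unfolding Hall_sub_def by simp
  then have "permutable (H \<inter> D) (K \<inter> (H \<inter> D))"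
    by (rule permutable_Int_Hall[OF sub_H permutable_K _ blocks])
  moreover have "K \<inter> (H \<inter> D) = K \<inter> D" using sub_K(2) by blast
  ultimately have "sigma_subnormal \<sigma> (G\<lparr>carrier := H \<inter> D\<rparr>) (K \<inter> D)"
    using sigma_subnormal_if_permutable[OF sHD] by simp
  then show ?thesis using sigma_subnormal_trans[OF _ H_Int_D_subnormal] subnormal_D by blast
qed

text \<open>\<open>K\<close> is known to permute only with Hall subgroups of \<open>H\<close>, so
  \<open>subset_if_permutes\<close> is used twice: from HD down to \<open>H\<close>, then from KD
  \<inter> H down to \<open>K\<close>. Both indices divide orders of subgroups of \<open>D\<close>,
  hence involve no prime of \<open>t\<close>.\<close>

lemma subset_K_if_subset_KD:
  assumes t: "t \<in> \<sigma>" "t \<inter> \<pi> = {}" and P: "subgroup P G" "P \<subseteq> K <#> D" "pi_number t (card P)"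
  shows "P \<subseteq> K"
proof -
  have comp: "pi_number (- t) n" if "pi_number \<pi> n" for n
    using that t(2) by (auto elim!: pi_number_mono)
  have HD: "subgroup (H <#> D) G"
    by (rule subgroup_set_mult[OF sub_H sub_D normal_commute[OF normal_D sub_H, symmetric]])
  have iH: "pi_number (- t) (card (H <#> D) div card H)"
    using comp[OF pi_number_dvd[OF pi_D(1) index_dvd[OF subgroups_Inter_pair[OF sub_H sub_D] sub_D]]]
    unfolding index_set_mult[OF sub_H sub_D] by simp
  have "P \<subseteq> H"
  proof (rule subset_if_permutes[OF subgroup_self sub_H HD _ _ t(1) _ iH P(1) _ P(3)])
    show "H \<subseteq> H <#> D" by (rule subset_set_mult(1)[OF sub_H sub_D])
    show "H <#> D \<subseteq> carrier G" by (rule subgroup.subset[OF HD])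
    show "H <#> Q = Q <#> H" if "Hall_sub G (carrier G) t Q" for Q
      using permutable_H t(1) that unfolding permutable_def by blast
    show "P \<subseteq> H <#> D" using P(2) mono_set_mult[OF sub_K(2) subset_refl, of G D] by blast
  qed
  define B where "B = (K <#> D) \<inter> H"
  have B: "subgroup B G" "B \<subseteq> H" "K \<subseteq> B"
    using subgroups_Inter_pair[OF sub_KD sub_H] subset_set_mult(1)[OF sub_K(1) sub_D] sub_K(2)
    unfolding B_def by auto
  have sDH: "subgroup (D \<inter> H) G" by (rule subgroups_Inter_pair[OF sub_D sub_H])
  have BK: "B = K <#> (D \<inter> H)"
    unfolding B_def by (rule set_mult_modular(1)[OF sub_K(1) sub_H sub_K(2) subgroup.subset[OF sub_D]])
  have "card B div card K dvd card (D \<inter> H)"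
    unfolding BK index_set_mult[OF sub_K(1) sDH]
    by (rule index_dvd[OF subgroups_Inter_pair[OF sub_K(1) sDH] sDH Int_lower2])
  then have iK: "pi_number (- t) (card B div card K)"
    using comp[OF pi_number_dvd[OF pi_Int_D[OF sub_H]]] by (simp add: Int_commute)
  show ?thesis
  proof (rule subset_if_permutes[OF sub_H sub_K(1) B(1,3,2) t(1) _ iK P(1) _ P(3)])
    show "K <#> Q = Q <#> K" if "Hall_sub G H t Q" for Q
      using permutable_K t(1) that unfolding permutable_def by blast
    show "P \<subseteq> B" using P(2) \<open>P \<subseteq> H\<close> unfolding B_def by blast
  qed
qed

text \<open>\<open>K \<inter> D\<close> is normal in G and so lies in the core, while its index in
  \<open>K\<close> is a \<pi>'-number; hence \<open>p\<close> is outside \<pi>.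
  \<open>not_dvd_index_Core\<close> then gives a subgroup that the later lemmas force into
  \<open>K\<close> for a contradiction.\<close>

lemma prime_dvd_index_Core:
  assumes U: "subgroup U G" "K \<subseteq> U" and p: "Factorial_Ring.prime p" "p dvd card K div card (Core U K)"
  obtains t P where "t \<in> \<sigma>" "p \<in> t" "t \<inter> \<pi> = {}" "subgroup P G" "P \<subseteq> U" "pi_number t (card P)" "\<not> P \<subseteq> K"
proof -
  note C = subgroup_Core[OF U(1) sub_K(1) U(2)] Core_subset[OF U(1) sub_K(1) U(2)]
  obtain t where t: "t \<in> \<sigma>" "p \<in> t" using block_of_prime[OF p(1)] .
  have sL: "subgroup (K \<inter> D) G" by (rule subgroups_Inter_pair[OF sub_K(1) sub_D])
  have "K \<inter> D \<subseteq> Core U K"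
  proof (rule subset_Core[OF U(1) sub_K(1) U(2) sL])
    show "conjugate G x (K \<inter> D) \<subseteq> K" if "x \<in> U" for x
      using normal_conjugate[OF K_Int_D_normal subgroup.mem_carrier[OF U(1) that]] by blast
  qed simp
  then have "p dvd card K div card (K \<inter> D)" using index_mult[OF sL C(1) sub_K(1) _ C(2)] p(2) by simp
  then have "p \<notin> \<pi>"
    using index_Int_normal_Hall[OF normal_D pi_D(2) sub_K(1)] p(1) unfolding pi_number_def by blast
  then have t\<pi>: "t \<inter> \<pi> = {}" using blocks[OF t(1)] t(2) by blast
  have "p dvd card U div card (Core U K)" using index_mult[OF C(1) sub_K(1) U(1) C(2) U(2)] p(2) by simp
  then obtain P where P: "subgroup P G" "P \<subseteq> U" "pi_number {p} (card P)" "\<not> P \<subseteq> K"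
    using not_dvd_index_Core[OF U(1) sub_K(1) U(2) p(1)] by blast
  have "pi_number t (card P)" using P(3) t(2) by (auto elim!: pi_number_mono)
  then show ?thesis using that t t\<pi> P by blast
qed

text \<open>For U = KD the subgroup from \<open>prime_dvd_index_Core\<close> contradicts
  \<open>subset_K_if_subset_KD\<close>, so \<open>K\<close> equals its core.\<close>

lemma KD_normalizes_K:
  assumes "x \<in> K <#> D"
  shows "conjugate G x K \<subseteq> K"
proof -
  have sub: "K \<subseteq> K <#> D" by (rule subset_set_mult(1)[OF sub_K(1) sub_D])
  have "card K div card (Core (K <#> D) K) = 1"
  proof (rule ccontr)
    assume "card K div card (Core (K <#> D) K) \<noteq> 1"
    then obtain p where p: "Factorial_Ring.prime p" "p dvd card K div card (Core (K <#> D) K)"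
      using prime_factor_nat by blast
    show False
      by (rule prime_dvd_index_Core[OF sub_KD sub p]) (use subset_K_if_subset_KD in blast)
  qed
  then have "Core (K <#> D) K = K"
    by (rule index_eq_1[OF subgroup_Core[OF sub_KD sub_K(1) sub] sub_K(1) Core_subset[OF sub_KD sub_K(1) sub]])
  then show ?thesis using conjugate_Core[OF sub_KD sub_K(1) sub assms] by simp
qed

text \<open>\<open>Q\<close> may fail to normalise \<open>K\<close>, but it normalises the core
  \<open>R\<close> of \<open>K\<close> in U = KDQ. So \<open>K\<close> is written as RS with
  \<open>S\<close> inside \<open>Q\<close>.\<close>

lemma commute_Hall_outside:
  assumes s: "s \<in> \<sigma>" "s \<inter> \<pi> = {}" and Q: "Hall_sub G (carrier G) s Q"
  shows "K <#> Q = Q <#> K"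
proof -
  have Q': "subgroup Q G" "pi_number s (card Q)" "pi_number (- s) (card (carrier G) div card Q)"
    using Q unfolding Hall_sub_def by auto
  have KDQ: "(K <#> D) <#> Q = Q <#> (K <#> D)" using permutable_KD s(1) Q unfolding permutable_def by blast
  define U where "U = (K <#> D) <#> Q"
  have U: "subgroup U G" unfolding U_def by (rule subgroup_set_mult[OF sub_KD Q'(1) KDQ])
  have sub: "K <#> D \<subseteq> U" "Q \<subseteq> U" unfolding U_def by (rule subset_set_mult[OF sub_KD Q'(1)])+
  have KKD: "K \<subseteq> K <#> D" by (rule subset_set_mult(1)[OF sub_K(1) sub_D])
  have KU: "K \<subseteq> U" using KKD sub(1) by blast
  have iU: "pi_number s (card U div card (K <#> D))"
    unfolding U_def index_set_mult[OF sub_KD Q'(1)]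
    by (rule pi_number_dvd[OF Q'(2) index_dvd[OF subgroups_Inter_pair[OF sub_KD Q'(1)] Q'(1)]]) simp
  define R where "R = Core U K"
  have R: "subgroup R G" "R \<subseteq> K" "\<And>x. x \<in> U \<Longrightarrow> conjugate G x R \<subseteq> R"
    unfolding R_def using subgroup_Core[OF U sub_K(1) KU] Core_subset[OF U sub_K(1) KU] conjugate_Core[OF U sub_K(1) KU]
    by auto
  \<comment> \<open>A prime outside \<open>s\<close> would yield a t-subgroup of \<open>U\<close>
    outside \<open>K\<close>, with \<open>t\<close> different from \<open>s\<close>. As |U:KD| is an
    s-number, that subgroup lies in KD and hence in \<open>K\<close>.\<close>
  have KR: "pi_number s (card K div card R)"
    unfolding pi_number_def
  proof (intro allI impI, rule ccontr)
    fix p assume p: "Factorial_Ring.prime p" "p dvd card K div card R" "p \<notin> s"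
    obtain t P where t: "t \<in> \<sigma>" "p \<in> t" "t \<inter> \<pi> = {}"
      and P: "subgroup P G" "P \<subseteq> U" "pi_number t (card P)" "\<not> P \<subseteq> K"
      using prime_dvd_index_Core[OF U KU p(1) p(2)[unfolded R_def]] .
    have "t \<noteq> s" using t(2) p(3) by blast
    then have i: "pi_number (- t) (card U div card (K <#> D))"
      using iU disjoint_blocks[OF t(1) s(1)] by (auto elim!: pi_number_mono)
    have "P \<subseteq> K <#> D"
    proof (rule subset_if_permutes[OF subgroup_self sub_KD U sub(1) subgroup.subset[OF U] t(1) _ i P(1-3)])
      show "(K <#> D) <#> Q = Q <#> (K <#> D)" if "Hall_sub G (carrier G) t Q" for Q
        using permutable_KD t(1) that unfolding permutable_def by blast
    qed
    then show False using subset_K_if_subset_KD[OF t(1,3) P(1) _ P(3)] P(4) by blast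
  qed
  \<comment> \<open>\<open>Q1\<close> is a Hall s-subgroup of KD, because |KD:Q1| = |U:Q|. Since KD
    normalises \<open>K\<close>, the product of \<open>Q1\<close> and \<open>K\<close> is a
    subgroup, and |K : K \<inter> Q| is its index over \<open>Q1\<close>, again an
    s'-number.\<close>
  define Q1 where "Q1 = Q \<inter> (K <#> D)"
  have Q1: "subgroup Q1 G" "Q1 \<subseteq> K <#> D"
    unfolding Q1_def using subgroups_Inter_pair[OF Q'(1) sub_KD] by auto
  have "pi_number (- s) (card (Q <#> (K <#> D)) div card Q)"
    using Q'(3) index_mult[OF Q'(1) U subgroup_self sub(2) subgroup.subset[OF U]]
    unfolding U_def KDQ by (simp add: pi_number_mult)
  then have i1: "pi_number (- s) (card (K <#> D) div card Q1)"
    unfolding index_set_mult[OF Q'(1) sub_KD] Q1_def .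
  have KQ1: "K <#> Q1 = Q1 <#> K"
    by (rule set_mult_commute_if_normalizes[OF sub_K(1) Q1(1)]) (use KD_normalizes_K Q1(2) in blast)
  have sQ1K: "subgroup (Q1 <#> K) G" by (rule subgroup_set_mult[OF Q1(1) sub_K(1) KQ1[symmetric]])
  have "pi_number (- s) (card (Q1 <#> K) div card Q1)"
    using i1 index_mult[OF Q1(1) sQ1K sub_KD subset_set_mult(1)[OF Q1(1) sub_K(1)] set_mult_least[OF sub_KD Q1(2) KKD]]
    by (simp add: pi_number_mult)
  moreover have "Q1 \<inter> K = K \<inter> Q" unfolding Q1_def using KKD by blast
  ultimately have i2: "pi_number (- s) (card K div card (K \<inter> Q))"
    unfolding index_set_mult[OF Q1(1) sub_K(1)] by simp
  define S where "S = K \<inter> Q"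
  have S: "subgroup S G" "S \<subseteq> K" "S \<subseteq> Q" unfolding S_def using subgroups_Inter_pair[OF sub_K(1) Q'(1)] by auto
  have "R <#> S = S <#> R"
    by (rule set_mult_commute_if_normalizes[OF R(1) S(1)]) (use R(3) S(2) KU in blast)
  then have RS: "subgroup (R <#> S) G" by (rule subgroup_set_mult[OF R(1) S(1)])
  have RSK: "R <#> S \<subseteq> K" by (rule set_mult_least[OF sub_K(1) R(2) S(2)])
  \<comment> \<open>The index of RS in \<open>K\<close> divides both |K:R| and |K:S|, an s-number
    and an s'-number.\<close>
  have "pi_number s (card K div card (R <#> S))"
    using KR index_mult[OF R(1) RS sub_K(1) subset_set_mult(1)[OF R(1) S(1)] RSK] by (simp add: pi_number_mult)
  moreover have "pi_number (- s) (card K div card (R <#> S))"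
    using i2 index_mult[OF S(1) RS sub_K(1) subset_set_mult(2)[OF R(1) S(1)] RSK]
    unfolding S_def by (simp add: pi_number_mult)
  ultimately have "card K div card (R <#> S) = 1" using pi_number_eq_1[of s _ "- s"] by blast
  then have KRS: "R <#> S = K" by (rule index_eq_1[OF RS sub_K(1) RSK])
  \<comment> \<open>\<open>S\<close> is absorbed by \<open>Q\<close>, so KQ = RSQ lies in RQ =
    QR.\<close>
  have "S <#> Q \<subseteq> Q" by (rule set_mult_least[OF Q'(1) S(3) subset_refl])
  then have "R <#> (S <#> Q) \<subseteq> R <#> Q" by (rule mono_set_mult[OF subset_refl])
  then have "K <#> Q \<subseteq> R <#> Q"
    using set_mult_assoc[OF subgroup.subset[OF R(1)] subgroup.subset[OF S(1)] subgroup.subset[OF Q'(1)]] KRS by simp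
  also have "\<dots> = Q <#> R"
    by (rule set_mult_commute_if_normalizes[OF R(1) Q'(1)]) (use R(3) sub(2) in blast)
  also have "\<dots> \<subseteq> Q <#> K" by (rule mono_set_mult[OF subset_refl R(2)])
  finally show ?thesis by (rule set_mult_commute_if_subset[OF sub_K(1) Q'(1)])
qed

text \<open>The index of \<open>Q \<inter> D\<close> in \<open>Q\<close> is both a \<pi>-number and
  a \<pi>'-number, so \<open>Q\<close> lies in \<open>D\<close> and normalises
  \<open>K\<close>.\<close>

lemma commute_Hall_inside:
  assumes s: "s \<subseteq> \<pi>" and Q: "Hall_sub G (carrier G) s Q"
  shows "K <#> Q = Q <#> K"
proof -
  have Q': "subgroup Q G" "pi_number \<pi> (card Q)"
    using Q s unfolding Hall_sub_def by (auto elim!: pi_number_mono)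
  have sQD: "subgroup (Q \<inter> D) G" by (rule subgroups_Inter_pair[OF Q'(1) sub_D])
  have "pi_number \<pi> (card Q div card (Q \<inter> D))"
    by (rule pi_number_dvd[OF Q'(2) index_dvd[OF sQD Q'(1)]]) simp
  then have "card Q div card (Q \<inter> D) = 1"
    using pi_number_eq_1[of \<pi> _ "- \<pi>"] index_Int_normal_Hall[OF normal_D pi_D(2) Q'(1)] by blast
  then have "Q \<inter> D = Q" by (rule index_eq_1[OF sQD Q'(1) Int_lower1])
  then have "Q \<subseteq> K <#> D" using subset_set_mult(2)[OF sub_K(1) sub_D] by blast
  then show ?thesis
    using set_mult_commute_if_normalizes[OF sub_K(1) Q'(1)] KD_normalizes_K by blast
qed

lemma permutable_K_G: "permutable (carrier G) K"
  unfolding permutable_def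
  using sub_K(1) subgroup.subset[OF sub_K(1)] commute_Hall_inside commute_Hall_outside blocks by blast

end

section \<open>Reduction of the theorem to chains over the normal Hall subgroup\<close>

theorem theoremA:
  fixes G :: "('a, 'b) monoid_scheme" and \<sigma> :: "nat set set" and D :: "'a set"
  assumes "partition_on all_primes \<sigma>"
    and "group G" and "finite (carrier G)"
    and "D \<lhd> G" and "sigma_hall \<sigma> G D"
    and "PsigmaT \<sigma> (G Mod D)"
    and "\<forall>A. sigma_subnormal \<sigma> (G\<lparr>carrier := D\<rparr>) A \<longrightarrow> A \<lhd> G"
    and "sigma_full_Sylow \<sigma> G"
  shows "PsigmaT \<sigma> G"
proof -
  interpret sylow_type G \<sigma>
    using assms by (simp add: sylow_type_def sylow_type_axioms_def fin_group_def fin_group_axioms_def)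
  obtain Ps where Ps: "Ps \<subseteq> \<sigma>" "hall_Pi \<sigma> G Ps D" using assms(5) unfolding sigma_hall_def by blast
  have Hall: "Hall_sub G (carrier G) (\<Union>Ps) D" using hall_Pi_iff[OF assms(1) Ps(1)] Ps(2) by simp
  have blocks: "s \<subseteq> \<Union>Ps \<or> s \<inter> \<Union>Ps = {}" if s: "s \<in> \<sigma>" for s
  proof (cases "s \<in> Ps")
    case False
    then have "s \<inter> t = {}" if "t \<in> Ps" for t using disjoint_blocks[OF s, of t] Ps(1) that by blast
    then show ?thesis by blast
  qed blast
  let ?h = "\<lambda>x. D #>\<^bsub>G\<^esub> x"
  have epi: "fin_epi G (G Mod D) ?h" by (rule fin_epi_Mod[OF assms(4)])
  have "sigma_quasinormal \<sigma> G K"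
    if K: "sigma_quasinormal \<sigma> (G\<lparr>carrier := H\<rparr>) K" and H: "sigma_quasinormal \<sigma> G H" for H K
  proof -
    have sH: "subgroup H G" using H unfolding sigma_quasinormal_def by simp
    have pH: "permutable (carrier G) H" using H quasinormal_iff_permutable[OF subgroup_self] by simp
    have pK: "permutable H K" using K quasinormal_iff_permutable[OF sH] by simp
    \<comment> \<open>To use transitivity in G/D, both links of the chain are projected; the lower
      one goes through the restriction of the projection to \<open>H\<close>.\<close>
    have "sigma_quasinormal \<sigma> ((G Mod D)\<lparr>carrier := ?h ` H\<rparr>) (?h ` K)"
      by (rule fin_epi.quasinormal_image[OF fin_epi.fin_epi_restrict[OF epi sH] assms(1) K])
    moreover have "sigma_quasinormal \<sigma> (G Mod D) (?h ` H)"
      by (rule fin_epi.quasinormal_image[OF epi assms(1) H])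
    ultimately have "sigma_quasinormal \<sigma> (G Mod D) (?h ` K)"
      using assms(6) unfolding PsigmaT_def by blast
    then have "permutable (carrier G) (K <#>\<^bsub>G\<^esub> D)"
      using permutable_if_quasinormal_Mod[OF assms(4)] pK unfolding permutable_def by blast
    then have "hall_chain G \<sigma> D (\<Union>Ps) H K"
      using assms(4,7) Hall blocks pH pK sylow_type_axioms
      by (simp add: hall_chain_def hall_chain_axioms_def)
    then have "permutable (carrier G) K" by (rule hall_chain.permutable_K_G)
    then show ?thesis using quasinormal_iff_permutable[OF subgroup_self] by simp
  qed
  then show ?thesis unfolding PsigmaT_def by blast
qed

end
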